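(* Let $p\ge3$ be a prime, $q\ge1$ an integer, $N\ge1$, $\theta=p^N$. Assume that $|q|_p<1$ and $|\theta|_p\le|q|_p^2$. Then for the translation-invariant $p$-adic quasi Gibbs measures $\mu_0,\mu_1,\mu_2$ of the ferromagnetic $p$-adic $(q+1)$-state Potts model with coupling constant $N$ on the Cayley tree $\Gamma^2_+$ of order two one has: the measure $\mu_1$ is bounded; the measures $\mu_0$ and $\mu_2$ are unbounded. Moreover, there is a strong phase transition.
   Context: $\Gamma^2_+$ is the semi-infinite Cayley tree of order $2$ with root $x^0$ (the root has $2$ neighbours, every other vertex $3$). $V$ is its vertex set, $d$ the graph distance, $W_n=\{x\in V:d(x,x^0)=n\}$, $V_n=\bigcup_{m=1}^nW_m$, $L_n$ the set of edges with both endpoints in $V_n$. $\Phi=\{0,1,\dots,q\}$, $\Omega_{V_n}=\Phi^{V_n}$, $H_n(\sigma)=N\sum_{\langle x,y\rangle\in L_n}\delta_{\sigma(x),\sigma(y)}$. For $\mathbf{h}:V\setminus\{x^0\}\to\mathbb{Q}_p^{q+1}$, $\mathbf{h}_x=(h_{0,x},\dots,h_{q,x})$ with $h_{0,x}\ne0$, put $$\mu^{(n)}_{\mathbf{h}}(\sigma)=\frac{1}{Z_n^{(\mathbf{h})}}p^{H_n(\sigma)}\prod_{x\in W_n}h_{\sigma(x),x},\quad \sigma\in\Omega_{V_n},$$ with $Z_n^{(\mathbf{h})}$ the normalizing factor (nonzero). If these measures are compatible ($\sum_{\omega\in\Phi^{W_n}}\mu^{(n)}_{\mathbf{h}}(\sigma\vee\omega)=\mu^{(n-1)}_{\mathbf{h}}(\sigma)$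 for $\sigma\in\Omega_{V_{n-1}}$, $n\ge2$, where $\sigma\vee\omega$ equals $\sigma$ on $V_{n-1}$ and $\omega$ on $W_n$), the unique $\mathbb{Q}_p$-valued finitely additive probability measure $\mu_{\mathbf{h}}$ on the algebra of cylinder sets extending all $\mu^{(n)}_{\mathbf{h}}$ is called a $p$-adic quasi Gibbs measure. For $\sigma\in\Omega_{V_n}$ we identify $\sigma$ with the corresponding cylinder set. Fix $m\in\{1,\dots,q\}$. For $i=0,1,2$, $\mu_i=\mu_{\mathbf{h}}$ for the constant (translation-invariant) function $\mathbf{h}_x=(h_0,\dots,h_q)$, $h_0\ne0$, with $h_m/h_0=x_i$ and $h_j/h_0=1$ for $j\in\{1,\dots,q\}\setminus\{m\}$; here $x_0=1$ and $x_1,x_2\in\mathbb{Q}_p$ are the roots of $x^2+(2\theta-\theta^2+2q-1)x+q^2=0$ labelled so that $|x_1|_p=|q|_p^2$, $|x_2|_p=1$ (they exist in $\mathbb{Q}_p$ under these hypotheses). (The numbers $x_0,x_1,x_2$ are the fixed points of $f(x)=\left(\frac{\theta x+q}{x+\theta+q-1}\right)^2$.) A $p$-adic probability measure $\mu$ is bounded if $\sup\{|\mu(A)|_p\}<\infty$ over all $A$ in the algebra, and unbounded otherwise. A phase transition occurs if there are two quasi Gibbs measures $\mu,\nu$ of the model with $\mu$ bounded and $\nu$ unbounded; it is a strong phase transition if moreover there is a sequence $A_n\in\Omega_{V_n}$ with $|\mu(A_n)|_p\to0$ and $|\nu(A_n)|_p\to\infty$ as $n\to\infty$. *)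

theory Defs
  imports
    "HOL-Analysis.Measure_Space"
    "HOL-Computational_Algebra.Primes"
    "HOL-Library.FuncSet"
    "HOL-Library.Cardinality"
begin

section \<open>The field of p-adic numbers\<close>

subsection \<open>The p-adic absolute value on the rationals\<close>

definition rat_pabs :: "nat \<Rightarrow> rat \<Rightarrow> real" where
  "rat_pabs p r = (if r = 0 then 0 else
     (case quotient_of r of (a, b) \<Rightarrow>
        real p powi (int (multiplicity (int p) b) - int (multiplicity (int p) a))))"

lemma rat_pabs_0 [simp]: "rat_pabs p 0 = 0"
  by (simp add: rat_pabs_def)

context
  fixes p :: nat
  assumes p: "prime p"
begin

lemma rat_pabs_frac:
  assumes "a \<noteq> 0" "b \<noteq> 0"
  shows "rat_pabs p (of_int a / of_int b) =
    real p powi (int (multiplicity (int p) b) - int (multiplicity (int p) a))"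
proof -
  obtain a' b' where q: "quotient_of (of_int a / of_int b) = (a', b')" by force
  have b': "b' > 0" using q by (rule quotient_of_denom_pos)
  have e: "(of_int a / of_int b :: rat) = of_int a' / of_int b'" using q by (rule quotient_of_div)
  with assms b' have "(of_int (a * b') :: rat) = of_int (a' * b)"
    by (simp add: field_simps)
  hence ab: "a * b' = a' * b" by (simp only: of_int_eq_iff)
  with assms b' have a': "a' \<noteq> 0" by auto
  have pe: "prime_elem (int p)" using p by simp
  have "multiplicity (int p) (a * b') = multiplicity (int p) (a' * b)" using ab by simp
  hence "multiplicity (int p) a + multiplicity (int p) b' = multiplicity (int p) a' + multiplicity (int p) b"
    using prime_elem_multiplicity_mult_distrib[OF pe] assms a' b' by simp
  hence "int (multiplicity (int p) b') - int (multiplicity (int p) a') =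
      int (multiplicity (int p) b) - int (multiplicity (int p) a)" by linarith
  thus ?thesis using assms by (simp add: rat_pabs_def q)
qed

lemma rat_frac_cases:
  obtains (zero) "r = (0::rat)" | (frac) a b where "a \<noteq> 0" "b \<noteq> 0" "r = of_int a / of_int b"
proof (cases "r = 0")
  case False
  obtain a b where q: "quotient_of r = (a, b)" by force
  have "r = of_int a / of_int b" "b > 0"
    using quotient_of_div[OF q] quotient_of_denom_pos[OF q] by auto
  with False show ?thesis by (intro frac[of a b]) auto
qed (use zero in auto)

lemma rat_pabs_nonneg [simp]: "rat_pabs p r \<ge> 0"
  by (cases "quotient_of r") (simp add: rat_pabs_def zero_le_power_int)

lemma rat_pabs_eq_0 [simp]: "rat_pabs p r = 0 \<longleftrightarrow> r = 0"
  using p prime_gt_0_nat by (cases "quotient_of r") (auto simp add: rat_pabs_def)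

lemma rat_pabs_minus [simp]: "rat_pabs p (- r) = rat_pabs p r"
proof (cases r rule: rat_frac_cases)
  case (frac a b)
  have "- r = of_int (- a) / of_int b" using frac by simp
  moreover have "multiplicity (int p) (- a) = multiplicity (int p) a"
    using multiplicity_times_unit_right[of "-1" "int p" a] by simp
  ultimately show ?thesis using rat_pabs_frac[of a b] rat_pabs_frac[of "-a" b] frac
    by simp
qed simp

lemma rat_pabs_mult: "rat_pabs p (r * s) = rat_pabs p r * rat_pabs p s"
proof (cases r rule: rat_frac_cases)
  case r: (frac a b)
  show ?thesis
  proof (cases s rule: rat_frac_cases)
    case s: (frac c d)
    have pe: "prime_elem (int p)" using p by simp
    have "r * s = of_int (a * c) / of_int (b * d)" using r s by simp
    thus ?thesis using rat_pabs_frac[of "a*c" "b*d"] r s rat_pabs_frac[of a b] rat_pabs_frac[of c d] prime_gt_0_nat[OF p]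
      by (simp add: prime_elem_multiplicity_mult_distrib[OF pe] power_int_add[symmetric] algebra_simps)
  qed simp
qed simp

lemma rat_pabs_1 [simp]: "rat_pabs p 1 = 1"
  using rat_pabs_frac[of 1 1] by simp

lemma rat_pabs_inverse: "rat_pabs p (inverse r) = inverse (rat_pabs p r)"
proof (cases "r = 0")
  case False
  have "rat_pabs p (inverse r) * rat_pabs p r = 1"
    unfolding rat_pabs_mult[symmetric] using False by simp
  thus ?thesis by (metis inverse_unique mult.commute)
qed simp

lemma rat_pabs_add_le_max: "rat_pabs p (r + s) \<le> max (rat_pabs p r) (rat_pabs p s)"
proof (cases "r = 0 \<or> s = 0 \<or> r + s = 0")
  case False
  obtain a b where r: "a \<noteq> 0" "b \<noteq> 0" "r = of_int a / of_int b"
    using False by (cases r rule: rat_frac_cases) auto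
  obtain c d where s: "c \<noteq> 0" "d \<noteq> 0" "s = of_int c / of_int d"
    using False by (cases s rule: rat_frac_cases) auto
  have r': "r = of_int (a * d) / of_int (b * d)" and s': "s = of_int (c * b) / of_int (b * d)"
    using r s by simp_all
  have rs: "r + s = of_int (a * d + c * b) / of_int (b * d)"
    unfolding r' s' by (simp add: add_divide_distrib)
  have nz: "a * d + c * b \<noteq> 0"
  proof
    assume "a * d + c * b = 0"
    with rs have "r + s = 0" by (simp only: of_int_0 div_0)
    with False show False by simp
  qed
  define k where "k = min (multiplicity (int p) (a * d)) (multiplicity (int p) (c * b))"
  have "int p ^ k dvd a * d + c * b"
    by (intro dvd_add multiplicity_dvd') (auto simp: k_def)
  hence k: "k \<le> multiplicity (int p) (a * d + c * b)"
    using nz p by (intro multiplicity_geI) (auto simp: prime_gt_1_nat)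
  have p1: "real p \<ge> 1" using prime_ge_1_nat[OF p] by simp
  have "rat_pabs p (r + s) =
      real p powi (int (multiplicity (int p) (b * d)) - int (multiplicity (int p) (a * d + c * b)))"
    unfolding rs using nz r s by (intro rat_pabs_frac) auto
  also have "\<dots> \<le> real p powi (int (multiplicity (int p) (b * d)) - int k)"
    using k p1 by (intro power_int_increasing) auto
  also have "\<dots> \<le> max (rat_pabs p r) (rat_pabs p s)"
  proof -
    have "rat_pabs p r = real p powi (int (multiplicity (int p) (b * d)) - int (multiplicity (int p) (a * d)))"
      unfolding r' using r s by (intro rat_pabs_frac) auto
    moreover have "rat_pabs p s = real p powi (int (multiplicity (int p) (b * d)) - int (multiplicity (int p) (c * b)))"
      unfolding s' using r s by (intro rat_pabs_frac) auto
    ultimately show ?thesis by (auto simp: k_def min_def)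
  qed
  finally show ?thesis .
qed (auto simp: max_def)

lemma rat_pabs_triangle: "rat_pabs p (r + s) \<le> rat_pabs p r + rat_pabs p s"
  using rat_pabs_add_le_max[of r s] rat_pabs_nonneg[of r] rat_pabs_nonneg[of s] by linarith

lemma rat_pabs_commute: "rat_pabs p (r - s) = rat_pabs p (s - r)"
  using rat_pabs_minus[of "r - s"] by simp

lemma rat_pabs_diff_abs: "\<bar>rat_pabs p r - rat_pabs p s\<bar> \<le> rat_pabs p (r - s)"
  using rat_pabs_triangle[of "r - s" s] rat_pabs_triangle[of "s - r" r] rat_pabs_commute[of r s] by simp

end

subsection \<open>The completion: Cauchy sequences modulo null sequences\<close>

definition padic_null :: "nat \<Rightarrow> (nat \<Rightarrow> rat) \<Rightarrow> bool" where
  "padic_null p X \<longleftrightarrow> (\<lambda>n. rat_pabs p (X n)) \<longlonglongrightarrow> 0"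

definition padic_Cauchy :: "nat \<Rightarrow> (nat \<Rightarrow> rat) \<Rightarrow> bool" where
  "padic_Cauchy p X \<longleftrightarrow> (\<forall>e>0. \<exists>k. \<forall>m\<ge>k. \<forall>n\<ge>k. rat_pabs p (X m - X n) < e)"

definition padic_rel :: "nat \<Rightarrow> (nat \<Rightarrow> rat) \<Rightarrow> (nat \<Rightarrow> rat) \<Rightarrow> bool" where
  "padic_rel p X Y \<longleftrightarrow> padic_Cauchy p X \<and> padic_Cauchy p Y \<and> padic_null p (\<lambda>n. X n - Y n)"

context
  fixes p :: nat
  assumes p: "prime p"
begin

lemma padic_null_dominated:
  assumes "padic_null p X" "\<And>n. rat_pabs p (Y n) \<le> C * rat_pabs p (X n)"
  shows "padic_null p Y"
  unfolding padic_null_def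
proof (rule tendsto_sandwich[OF _ _ tendsto_const])
  show "(\<lambda>n. C * rat_pabs p (X n)) \<longlonglongrightarrow> 0"
    using tendsto_mult[OF tendsto_const assms(1)[unfolded padic_null_def], of C] by simp
qed (use assms rat_pabs_nonneg[OF p] in auto)

lemma padic_null_minus: "padic_null p X \<Longrightarrow> padic_null p (\<lambda>n. - X n)"
  by (simp add: padic_null_def rat_pabs_minus[OF p])

lemma padic_null_add:
  assumes "padic_null p X" "padic_null p Y" shows "padic_null p (\<lambda>n. X n + Y n)"
  unfolding padic_null_def
proof (rule tendsto_sandwich[OF _ _ tendsto_const])
  show "(\<lambda>n. rat_pabs p (X n) + rat_pabs p (Y n)) \<longlonglongrightarrow> 0"
    using tendsto_add[OF assms[unfolded padic_null_def]] by simp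
qed (use rat_pabs_nonneg[OF p] rat_pabs_triangle[OF p] in auto)

lemma padic_null_diff:
  "padic_null p X \<Longrightarrow> padic_null p Y \<Longrightarrow> padic_null p (\<lambda>n. X n - Y n)"
  using padic_null_add[OF _ padic_null_minus, of X Y] by simp

lemma padic_Cauchy_const [simp]: "padic_Cauchy p (\<lambda>n. c)"
  by (simp add: padic_Cauchy_def)

lemma padic_Cauchy_abs_convergent:
  assumes "padic_Cauchy p X"
  shows "convergent (\<lambda>n. rat_pabs p (X n))"
proof (rule Cauchy_convergent, rule metric_CauchyI)
  fix e :: real assume "e > 0"
  then obtain k where "\<forall>m\<ge>k. \<forall>n\<ge>k. rat_pabs p (X m - X n) < e"
    using assms unfolding padic_Cauchy_def by blast
  thus "\<exists>M. \<forall>m\<ge>M. \<forall>n\<ge>M. dist (rat_pabs p (X m)) (rat_pabs p (X n)) < e"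
    unfolding dist_real_def using rat_pabs_diff_abs[OF p] le_less_trans by blast
qed

lemma padic_Cauchy_bounded:
  assumes "padic_Cauchy p X"
  obtains C where "C > 0" "\<And>n. rat_pabs p (X n) \<le> C"
proof -
  have "Bseq (\<lambda>n. rat_pabs p (X n))"
    using convergent_imp_Bseq[OF padic_Cauchy_abs_convergent[OF assms]] .
  then obtain C where "C > 0" "\<And>n. norm (rat_pabs p (X n)) \<le> C" by (auto elim: BseqE)
  thus ?thesis using that[of C] by (auto simp: abs_le_iff)
qed

lemma padic_Cauchy_dominated:
  assumes X: "padic_Cauchy p X" and Y: "padic_Cauchy p Y" and "A > 0" "B > 0"
    and le: "\<And>m n. m \<ge> k0 \<Longrightarrow> n \<ge> k0 \<Longrightarrow>
      rat_pabs p (Z m - Z n) \<le> A * rat_pabs p (X m - X n) + B * rat_pabs p (Y m - Y n)"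
  shows "padic_Cauchy p Z"
  unfolding padic_Cauchy_def
proof (intro allI impI)
  fix e :: real assume e: "e > 0"
  obtain k1 where k1: "\<And>m n. m \<ge> k1 \<Longrightarrow> n \<ge> k1 \<Longrightarrow> rat_pabs p (X m - X n) < e / 2 / A"
    using X e \<open>A > 0\<close> unfolding padic_Cauchy_def by (meson divide_pos_pos half_gt_zero)
  obtain k2 where k2: "\<And>m n. m \<ge> k2 \<Longrightarrow> n \<ge> k2 \<Longrightarrow> rat_pabs p (Y m - Y n) < e / 2 / B"
    using Y e \<open>B > 0\<close> unfolding padic_Cauchy_def by (meson divide_pos_pos half_gt_zero)
  show "\<exists>k. \<forall>m\<ge>k. \<forall>n\<ge>k. rat_pabs p (Z m - Z n) < e"
  proof (intro exI allI impI)
    fix m n assume "m \<ge> max k0 (max k1 k2)" "n \<ge> max k0 (max k1 k2)"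
    hence "rat_pabs p (Z m - Z n) \<le> A * rat_pabs p (X m - X n) + B * rat_pabs p (Y m - Y n)"
      and "A * rat_pabs p (X m - X n) < e / 2" "B * rat_pabs p (Y m - Y n) < e / 2"
      using le[of m n] k1[of m n] k2[of m n] \<open>A > 0\<close> \<open>B > 0\<close> by (simp_all add: field_simps)
    thus "rat_pabs p (Z m - Z n) < e" by linarith
  qed
qed

lemma padic_Cauchy_add:
  assumes "padic_Cauchy p X" "padic_Cauchy p Y" shows "padic_Cauchy p (\<lambda>n. X n + Y n)"
proof (rule padic_Cauchy_dominated[OF assms, of 1 1 0])
  fix m n
  show "rat_pabs p (X m + Y m - (X n + Y n)) \<le> 1 * rat_pabs p (X m - X n) + 1 * rat_pabs p (Y m - Y n)"
    using rat_pabs_triangle[OF p, of "X m - X n" "Y m - Y n"] by (simp add: algebra_simps)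
qed auto

lemma padic_Cauchy_minus: "padic_Cauchy p X \<Longrightarrow> padic_Cauchy p (\<lambda>n. - X n)"
  by (simp add: padic_Cauchy_def) (metis rat_pabs_commute[OF p])

lemma padic_Cauchy_mult:
  assumes "padic_Cauchy p X" "padic_Cauchy p Y" shows "padic_Cauchy p (\<lambda>n. X n * Y n)"
proof -
  obtain A where A: "A > 0" "\<And>n. rat_pabs p (X n) \<le> A" using padic_Cauchy_bounded[OF assms(1)] by blast
  obtain B where B: "B > 0" "\<And>n. rat_pabs p (Y n) \<le> B" using padic_Cauchy_bounded[OF assms(2)] by blast
  show ?thesis
  proof (rule padic_Cauchy_dominated[OF assms, of B A 0])
    fix m n
    have eq: "X m * Y m - X n * Y n = Y m * (X m - X n) + X n * (Y m - Y n)" by (simp add: algebra_simps)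
    have "rat_pabs p (X m * Y m - X n * Y n) \<le>
        rat_pabs p (Y m) * rat_pabs p (X m - X n) + rat_pabs p (X n) * rat_pabs p (Y m - Y n)"
      unfolding eq
      using rat_pabs_triangle[OF p, of "Y m * (X m - X n)" "X n * (Y m - Y n)"]
      unfolding rat_pabs_mult[OF p] .
    also have "\<dots> \<le> B * rat_pabs p (X m - X n) + A * rat_pabs p (Y m - Y n)"
      by (intro add_mono mult_right_mono A B rat_pabs_nonneg[OF p])
    finally show "rat_pabs p (X m * Y m - X n * Y n) \<le>
        B * rat_pabs p (X m - X n) + A * rat_pabs p (Y m - Y n)" .
  qed (use A B in auto)
qed

lemma padic_not_null_away:
  assumes X: "padic_Cauchy p X" and "\<not> padic_null p X"
  obtains c k where "c > 0" "\<And>n. n \<ge> k \<Longrightarrow> rat_pabs p (X n) \<ge> c"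
proof -
  obtain L where L: "(\<lambda>n. rat_pabs p (X n)) \<longlonglongrightarrow> L"
    using padic_Cauchy_abs_convergent[OF X] by (auto simp: convergent_def)
  have "L \<ge> 0" using L by (rule LIMSEQ_le_const) (simp add: rat_pabs_nonneg[OF p])
  moreover have "L \<noteq> 0" using L assms(2) by (auto simp: padic_null_def)
  ultimately have "L > L / 2" "L > 0" by auto
  hence "eventually (\<lambda>n. rat_pabs p (X n) > L / 2) sequentially"
    using order_tendstoD(1)[OF L] by blast
  then obtain k where "\<And>n. n \<ge> k \<Longrightarrow> rat_pabs p (X n) > L / 2"
    by (auto simp: eventually_sequentially)
  thus ?thesis using that[of "L/2" k] \<open>L > 0\<close> by (simp add: less_imp_le)
qed

lemma inverse_diff_pabs:
  assumes c: "c > 0" and "rat_pabs p x \<ge> c" "rat_pabs p y \<ge> c"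
  shows "rat_pabs p (inverse x - inverse y) \<le> inverse (c * c) * rat_pabs p (x - y)"
proof -
  have nz: "x \<noteq> 0" "y \<noteq> 0" using assms by auto
  hence "inverse x - inverse y = - (inverse (x * y) * (x - y))" by (simp add: field_simps)
  hence "rat_pabs p (inverse x - inverse y) = inverse (rat_pabs p x * rat_pabs p y) * rat_pabs p (x - y)"
    by (simp only: rat_pabs_minus[OF p] rat_pabs_mult[OF p] rat_pabs_inverse[OF p])
  also have "\<dots> \<le> inverse (c * c) * rat_pabs p (x - y)"
    using assms by (intro mult_right_mono le_imp_inverse_le mult_mono rat_pabs_nonneg[OF p]) auto
  finally show ?thesis .
qed

lemma padic_Cauchy_inverse:
  assumes X: "padic_Cauchy p X" and "\<not> padic_null p X"
  shows "padic_Cauchy p (\<lambda>n. inverse (X n))"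
proof -
  obtain c k where c: "c > 0" and k: "\<And>n. n \<ge> k \<Longrightarrow> rat_pabs p (X n) \<ge> c"
    using padic_not_null_away[OF assms] by blast
  show ?thesis
  proof (rule padic_Cauchy_dominated[OF X padic_Cauchy_const, of "inverse (c * c)" 1 k])
    fix m n assume "m \<ge> k" "n \<ge> k"
    thus "rat_pabs p (inverse (X m) - inverse (X n)) \<le>
        inverse (c * c) * rat_pabs p (X m - X n) + 1 * rat_pabs p (0 - 0)"
      using inverse_diff_pabs[OF c k k, of m n] by simp
  qed (use c in auto)
qed

lemma padic_null_eventually_dominated:
  assumes "padic_null p X" "\<And>n. n \<ge> k \<Longrightarrow> rat_pabs p (Y n) \<le> C * rat_pabs p (X n)"
  shows "padic_null p Y"
  unfolding padic_null_def
proof (rule tendsto_sandwich[OF _ _ tendsto_const])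
  show "(\<lambda>n. C * rat_pabs p (X n)) \<longlonglongrightarrow> 0"
    using tendsto_mult[OF tendsto_const assms(1)[unfolded padic_null_def], of C] by simp
  show "\<forall>\<^sub>F n in sequentially. rat_pabs p (Y n) \<le> C * rat_pabs p (X n)"
    using assms(2) by (auto simp: eventually_sequentially)
qed (use rat_pabs_nonneg[OF p] in auto)

lemma padic_rel_refl: "padic_Cauchy p X \<Longrightarrow> padic_rel p X X"
  by (simp add: padic_rel_def padic_null_def)

lemma part_equivp_padic_rel: "part_equivp (padic_rel p)"
proof (rule part_equivpI)
  show "\<exists>X. padic_rel p X X" using padic_rel_refl[OF padic_Cauchy_const] by blast
  show "symp (padic_rel p)"
    by (rule sympI) (auto simp: padic_rel_def padic_null_def rat_pabs_commute[OF p])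
  show "transp (padic_rel p)"
  proof (rule transpI)
    fix X Y Z assume "padic_rel p X Y" "padic_rel p Y Z"
    thus "padic_rel p X Z"
      using padic_null_add[of "\<lambda>n. X n - Y n" "\<lambda>n. Y n - Z n"] by (simp add: padic_rel_def)
  qed
qed

lemma padic_rel_null_iff: "padic_rel p X Y \<Longrightarrow> padic_null p X \<longleftrightarrow> padic_null p Y"
  using padic_null_add[of "\<lambda>n. X n - Y n" Y] padic_null_diff[of X "\<lambda>n. X n - Y n"]
  by (auto simp: padic_rel_def)

lemma padic_rel_lim:
  assumes "padic_rel p X Y"
  shows "lim (\<lambda>n. rat_pabs p (X n)) = lim (\<lambda>n. rat_pabs p (Y n))"
proof -
  obtain L where L: "(\<lambda>n. rat_pabs p (Y n)) \<longlonglongrightarrow> L"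
    using padic_Cauchy_abs_convergent assms by (auto simp: convergent_def padic_rel_def)
  have "(\<lambda>n. rat_pabs p (X n) - rat_pabs p (Y n)) \<longlonglongrightarrow> 0"
  proof (rule tendsto_rabs_zero_cancel, rule tendsto_sandwich[OF _ _ tendsto_const])
    show "(\<lambda>n. rat_pabs p (X n - Y n)) \<longlonglongrightarrow> 0" using assms by (simp add: padic_rel_def padic_null_def)
  qed (simp_all add: rat_pabs_diff_abs[OF p])
  from tendsto_add[OF this L] have "(\<lambda>n. rat_pabs p (X n)) \<longlonglongrightarrow> L" by simp
  with L show ?thesis by (simp add: limI)
qed

lemma padic_rel_add:
  assumes "padic_rel p X X'" "padic_rel p Y Y'"
  shows "padic_rel p (\<lambda>n. X n + Y n) (\<lambda>n. X' n + Y' n)"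
proof -
  have "padic_null p (\<lambda>n. (X n - X' n) + (Y n - Y' n))"
    using assms by (intro padic_null_add) (auto simp: padic_rel_def)
  thus ?thesis using assms by (auto simp: padic_rel_def padic_Cauchy_add algebra_simps)
qed

lemma padic_rel_minus:
  assumes "padic_rel p X X'" shows "padic_rel p (\<lambda>n. - X n) (\<lambda>n. - X' n)"
proof -
  have "padic_null p (\<lambda>n. - (X n - X' n))"
    using assms by (intro padic_null_minus) (auto simp: padic_rel_def)
  thus ?thesis using assms by (auto simp: padic_rel_def padic_Cauchy_minus)
qed

lemma padic_rel_mult:
  assumes "padic_rel p X X'" "padic_rel p Y Y'"
  shows "padic_rel p (\<lambda>n. X n * Y n) (\<lambda>n. X' n * Y' n)"
proof -
  obtain A where A: "\<And>n. rat_pabs p (X n) \<le> A"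
    using padic_Cauchy_bounded assms(1) unfolding padic_rel_def by metis
  obtain B where B: "\<And>n. rat_pabs p (Y' n) \<le> B"
    using padic_Cauchy_bounded assms(2) unfolding padic_rel_def by metis
  have "padic_null p (\<lambda>n. X n * (Y n - Y' n))"
    by (rule padic_null_dominated[where X = "\<lambda>n. Y n - Y' n" and C = A])
       (use assms A in \<open>auto simp: padic_rel_def rat_pabs_mult[OF p] intro!: mult_right_mono rat_pabs_nonneg[OF p]\<close>)
  moreover have "padic_null p (\<lambda>n. Y' n * (X n - X' n))"
    by (rule padic_null_dominated[where X = "\<lambda>n. X n - X' n" and C = B])
       (use assms B in \<open>auto simp: padic_rel_def rat_pabs_mult[OF p] intro!: mult_right_mono rat_pabs_nonneg[OF p]\<close>)
  ultimately have "padic_null p (\<lambda>n. X n * (Y n - Y' n) + Y' n * (X n - X' n))"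
    by (rule padic_null_add)
  thus ?thesis using assms by (auto simp: padic_rel_def padic_Cauchy_mult algebra_simps)
qed

lemma padic_rel_inverse:
  assumes XY: "padic_rel p X Y"
  shows "padic_rel p (if padic_null p X then (\<lambda>n. 0) else (\<lambda>n. inverse (X n)))
                     (if padic_null p Y then (\<lambda>n. 0) else (\<lambda>n. inverse (Y n)))"
proof (cases "padic_null p X")
  case True
  thus ?thesis using padic_rel_null_iff[OF XY] padic_rel_refl by simp
next
  case False
  hence Y: "\<not> padic_null p Y" using padic_rel_null_iff[OF XY] by simp
  have CX: "padic_Cauchy p X" and CY: "padic_Cauchy p Y" using XY by (auto simp: padic_rel_def)
  obtain c k where c: "c > 0" and k: "\<And>n. n \<ge> k \<Longrightarrow> rat_pabs p (X n) \<ge> c"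
    using padic_not_null_away[OF CX False] by blast
  obtain d l where d: "d > 0" and l: "\<And>n. n \<ge> l \<Longrightarrow> rat_pabs p (Y n) \<ge> d"
    using padic_not_null_away[OF CY Y] by blast
  have "padic_null p (\<lambda>n. inverse (X n) - inverse (Y n))"
  proof (rule padic_null_eventually_dominated)
    show "padic_null p (\<lambda>n. X n - Y n)" using XY by (simp add: padic_rel_def)
    fix n assume n: "n \<ge> max k l"
    show "rat_pabs p (inverse (X n) - inverse (Y n)) \<le>
        inverse (min c d * min c d) * rat_pabs p (X n - Y n)"
    proof (rule inverse_diff_pabs)
      show "min c d > 0" using c d by simp
      show "min c d \<le> rat_pabs p (X n)" "min c d \<le> rat_pabs p (Y n)"
        using k[of n] l[of n] n by auto
    qed
  qed
  thus ?thesis using False Y CX CY by (simp add: padic_rel_def padic_Cauchy_inverse)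
qed

end

text \<open>
  The prime enters as the cardinality of a type parameter, so that the field of p-adic numbers
  is a type in class \<^class>\<open>field\<close>; for instance \<open>5 padic\<close> is the field of 5-adic numbers.
  The value 2 of \<open>pchar\<close> at types whose cardinality is not prime only serves to make the
  construction total.
\<close>

definition pchar :: "'p itself \<Rightarrow> nat" where
  "pchar _ = (if prime CARD('p) then CARD('p) else 2)"

lemma prime_pchar: "prime (pchar TYPE('p))"
  by (simp add: pchar_def)

typedef 'p padic = "{A. \<exists>X. padic_rel (pchar TYPE('p)) X X \<and> A = Collect (padic_rel (pchar TYPE('p)) X)}"
  using padic_rel_refl[OF prime_pchar padic_Cauchy_const[OF prime_pchar]] by blast

definition padic_of :: "(nat \<Rightarrow> rat) \<Rightarrow> 'p padic" where
  "padic_of X = Abs_padic (Collect (padic_rel (pchar TYPE('p)) X))"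

definition padic_rep :: "'p padic \<Rightarrow> nat \<Rightarrow> rat" where
  "padic_rep x = (SOME X. X \<in> Rep_padic x)"

definition cr_padic :: "(nat \<Rightarrow> rat) \<Rightarrow> 'p padic \<Rightarrow> bool" where
  "cr_padic X x \<longleftrightarrow> padic_rel (pchar TYPE('p)) X X \<and> padic_of X = x"

lemma Quotient_padic:
  "Quotient (padic_rel (pchar TYPE('p))) (padic_of :: _ \<Rightarrow> 'p padic) padic_rep cr_padic"
proof -
  interpret quot_type "padic_rel (pchar TYPE('p))" "Abs_padic :: _ \<Rightarrow> 'p padic" Rep_padic
  proof
    show "part_equivp (padic_rel (pchar TYPE('p)))" by (rule part_equivp_padic_rel[OF prime_pchar])
  next
    fix x y :: "'p padic"
    show "\<exists>X. padic_rel (pchar TYPE('p)) X X \<and> Rep_padic x = Collect (padic_rel (pchar TYPE('p)) X)"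
      using Rep_padic[of x] by simp
    show "Abs_padic (Rep_padic x) = x" by (rule Rep_padic_inverse)
    show "Rep_padic x = Rep_padic y \<longleftrightarrow> x = y" by (rule Rep_padic_inject)
  next
    fix c assume "\<exists>X. padic_rel (pchar TYPE('p)) X X \<and> c = Collect (padic_rel (pchar TYPE('p)) X)"
    thus "Rep_padic (Abs_padic c :: 'p padic) = c" by (intro Abs_padic_inverse) simp
  qed
  have abs: "abs = padic_of" and rep: "rep = padic_rep"
    by (simp_all add: fun_eq_iff padic_of_def padic_rep_def abs_def rep_def)
  have cr: "cr_padic = (\<lambda>X x. padic_rel (pchar TYPE('p)) X X \<and> (padic_of X :: 'p padic) = x)"
    by (simp add: fun_eq_iff cr_padic_def)
  show ?thesis
    unfolding cr by (rule Quotient3_to_Quotient[OF Quotient[unfolded abs rep] reflexive])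
qed

setup_lifting Quotient_padic

instantiation padic :: (type) field
begin

lift_definition zero_padic :: "'a padic" is "\<lambda>n. 0"
  by (simp add: padic_rel_refl prime_pchar)

lift_definition one_padic :: "'a padic" is "\<lambda>n. 1"
  by (simp add: padic_rel_refl prime_pchar)

lift_definition plus_padic :: "'a padic \<Rightarrow> 'a padic \<Rightarrow> 'a padic" is "\<lambda>X Y n. X n + Y n"
  by (rule padic_rel_add[OF prime_pchar])

lift_definition uminus_padic :: "'a padic \<Rightarrow> 'a padic" is "\<lambda>X n. - X n"
  by (rule padic_rel_minus[OF prime_pchar])

lift_definition times_padic :: "'a padic \<Rightarrow> 'a padic \<Rightarrow> 'a padic" is "\<lambda>X Y n. X n * Y n"
  by (rule padic_rel_mult[OF prime_pchar])

lift_definition inverse_padic :: "'a padic \<Rightarrow> 'a padic"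
  is "\<lambda>X. if padic_null (pchar TYPE('a)) X then (\<lambda>n. 0) else (\<lambda>n. inverse (X n))"
  by (rule padic_rel_inverse[OF prime_pchar])

definition "x - y = x + - y" for x y :: "'a padic"

definition "x div y = x * inverse y" for x y :: "'a padic"

instance
proof
  fix a b c :: "'a padic"
  note C = padic_Cauchy_add[OF prime_pchar] padic_Cauchy_mult[OF prime_pchar]
    padic_Cauchy_minus[OF prime_pchar] padic_Cauchy_const[OF prime_pchar]
  show "a + b = b + a"
    by transfer (simp add: padic_rel_def C padic_null_def)
  show "a + b + c = a + (b + c)"
    by transfer (simp add: padic_rel_def C padic_null_def)
  show "0 + a = a"
    by transfer (simp add: padic_rel_def C padic_null_def)
  show "- a + a = 0"
    by transfer (simp add: padic_rel_def C padic_null_def)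
  show "a - b = a + - b" by (rule minus_padic_def)
  show "a * b * c = a * (b * c)"
    by transfer (simp add: padic_rel_def C padic_null_def)
  show "a * b = b * a"
    by transfer (simp add: padic_rel_def C padic_null_def mult.commute)
  show "1 * a = a"
    by transfer (simp add: padic_rel_def C padic_null_def)
  show "(a + b) * c = a * c + b * c"
    by transfer (simp add: padic_rel_def C padic_null_def distrib_right)
  show "(0::'a padic) \<noteq> 1"
    by transfer (simp add: padic_rel_def padic_null_def rat_pabs_minus[OF prime_pchar] rat_pabs_1[OF prime_pchar] LIMSEQ_const_iff)
  show "a div b = a * inverse b" by (rule divide_padic_def)
  show "inverse (0::'a padic) = 0"
    by transfer (simp add: padic_rel_def padic_null_def C)
  show "a \<noteq> 0 \<Longrightarrow> inverse a * a = 1"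
  proof transfer
    fix X :: "nat \<Rightarrow> rat"
    assume X: "padic_rel (pchar TYPE('a)) X X" and "\<not> padic_rel (pchar TYPE('a)) X (\<lambda>n. 0)"
    hence CX: "padic_Cauchy (pchar TYPE('a)) X" and N: "\<not> padic_null (pchar TYPE('a)) X"
      by (auto simp: padic_rel_def C)
    obtain c k where c: "c > 0" and k: "\<And>n. n \<ge> k \<Longrightarrow> rat_pabs (pchar TYPE('a)) (X n) \<ge> c"
      using padic_not_null_away[OF prime_pchar CX N] by blast
    have "padic_null (pchar TYPE('a)) (\<lambda>n. inverse (X n) * X n - 1)"
    proof (rule padic_null_eventually_dominated[OF prime_pchar])
      show "padic_null (pchar TYPE('a)) (\<lambda>n. 0)" by (simp add: padic_null_def)
      fix n assume "n \<ge> k"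
      with k c have "rat_pabs (pchar TYPE('a)) (X n) \<noteq> 0" by fastforce
      hence "X n \<noteq> 0" by auto
      thus "rat_pabs (pchar TYPE('a)) (inverse (X n) * X n - 1) \<le> 0 * rat_pabs (pchar TYPE('a)) 0" by auto
    qed
    thus "padic_rel (pchar TYPE('a)) (\<lambda>n. (if padic_null (pchar TYPE('a)) X then (\<lambda>n. 0) else (\<lambda>n. inverse (X n))) n * X n) (\<lambda>n. 1)"
      using N CX by (simp add: padic_rel_def C padic_Cauchy_inverse[OF prime_pchar])
  qed
qed

end

lift_definition padic_abs :: "'p padic \<Rightarrow> real" is
  "\<lambda>X. lim (\<lambda>n. rat_pabs (pchar TYPE('p)) (X n))"
  by (rule padic_rel_lim[OF prime_pchar])

lift_definition padic_of_rat :: "rat \<Rightarrow> 'p padic" is "\<lambda>r n. r"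
  by (simp add: padic_rel_refl prime_pchar)

lemma padic_abs_of_rat: "padic_abs (padic_of_rat r :: 'p padic) = rat_pabs (pchar TYPE('p)) r"
  by transfer simp

lemma padic_of_rat_of_nat: "padic_of_rat (of_nat n) = (of_nat n :: 'p padic)"
proof (induction n)
  case 0
  show ?case unfolding of_nat_0 by transfer (simp add: padic_rel_refl prime_pchar)
next
  case (Suc n)
  have "padic_of_rat (1 + of_nat n) = 1 + (padic_of_rat (of_nat n) :: 'p padic)"
    by transfer (simp add: padic_rel_refl prime_pchar)
  thus ?case by (simp add: Suc.IH)
qed

lemma padic_abs_of_nat: "padic_abs (of_nat n :: 'p padic) = rat_pabs (pchar TYPE('p)) (of_nat n)"
  unfolding padic_of_rat_of_nat[symmetric] by (rule padic_abs_of_rat)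


section \<open>The semi-infinite Cayley tree of order two\<close>

text \<open>Vertices are binary words: the root is the empty word and the successors of \<open>x\<close> are
  \<open>False # x\<close> and \<open>True # x\<close>.\<close>

type_synonym vertex = "bool list"

abbreviation tree_root :: vertex where "tree_root \<equiv> []"

definition adj :: "vertex \<Rightarrow> vertex \<Rightarrow> bool" where
  "adj x y \<longleftrightarrow> (\<exists>b. y = b # x) \<or> (\<exists>b. x = b # y)"

definition gdist :: "vertex \<Rightarrow> vertex \<Rightarrow> nat" where
  "gdist x y = (LEAST n. (adj ^^ n) x y)"

definition Wn :: "nat \<Rightarrow> vertex set" where
  "Wn n = {x. gdist x tree_root = n}"

definition Vn :: "nat \<Rightarrow> vertex set" where
  "Vn n = (\<Union>m\<in>{1..n}. Wn m)"

definition Ln :: "nat \<Rightarrow> vertex set set" where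
  "Ln n = {{x, y} | x y. adj x y \<and> x \<in> Vn n \<and> y \<in> Vn n}"

lemma adj_relpow_length: "(adj ^^ n) x y \<Longrightarrow> length x \<le> length y + n"
proof (induction n arbitrary: y)
  case (Suc n)
  then obtain z where "(adj ^^ n) x z" "adj z y" by auto
  moreover from this have "length z \<le> Suc (length y)" by (auto simp: adj_def)
  ultimately show ?case using Suc.IH[of z] by simp
qed auto

lemma adj_relpow_root: "(adj ^^ length x) x tree_root"
proof (induction x)
  case (Cons b x)
  have "adj (b # x) x" by (auto simp: adj_def)
  with Cons show ?case using relpowp_Suc_I2[of adj "b # x" x "length x" tree_root] by simp
qed auto

lemma gdist_root: "gdist x tree_root = length x"
  unfolding gdist_def
  by (rule Least_equality) (use adj_relpow_root adj_relpow_length[of _ x tree_root] in auto)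

lemma Wn_eq: "Wn n = {x. length x = n}"
  by (simp add: Wn_def gdist_root)

lemma Vn_eq: "Vn n = {x. x \<noteq> tree_root \<and> length x \<le> n}"
  by (auto simp: Vn_def Wn_eq Suc_le_eq)

lemma card_neighbours: "card {y. adj x y} = (if x = tree_root then 2 else 3)"
proof (cases x)
  case Nil
  hence "{y. adj x y} = {[True], [False]}" by (auto simp: adj_def)
  thus ?thesis using Nil by simp
next
  case (Cons b t)
  hence "{y. adj x y} = {True # x, False # x, t}" by (auto simp: adj_def)
  moreover have "t \<noteq> c # x" for c using Cons by (metis length_Cons n_not_Suc_n not_Cons_self2 Suc_n_not_le_n le_Suc_eq)
  ultimately show ?thesis using Cons by auto
qed


section \<open>The p-adic Potts model\<close>

type_synonym config = "vertex \<Rightarrow> nat"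

definition Conf :: "nat \<Rightarrow> vertex set \<Rightarrow> config set" where
  "Conf q A = A \<rightarrow>\<^sub>E {0..q}"

text \<open>Edges are two-element sets; the condition under the sum is \<open>\<sigma>(x) = \<sigma>(y)\<close> for the edge \<open>{x, y}\<close>.\<close>

definition hamiltonian :: "nat \<Rightarrow> nat \<Rightarrow> config \<Rightarrow> nat" where
  "hamiltonian N n \<sigma> = N * (\<Sum>e\<in>Ln n. if (\<forall>x\<in>e. \<forall>y\<in>e. \<sigma> x = \<sigma> y) then 1 else 0)"

text \<open>In the following, \<open>h x i\<close> is the \<open>i\<close>-th coordinate of the boundary field at the vertex \<open>x\<close>;
  only \<open>x \<noteq> tree_root\<close> and \<open>i \<le> q\<close> matter.\<close>

type_synonym 'p field_fun = "vertex \<Rightarrow> nat \<Rightarrow> 'p padic"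

definition weight :: "nat \<Rightarrow> 'p field_fun \<Rightarrow> nat \<Rightarrow> config \<Rightarrow> 'p padic" where
  "weight N h n \<sigma> = of_nat (pchar TYPE('p)) ^ hamiltonian N n \<sigma> * (\<Prod>x\<in>Wn n. h x (\<sigma> x))"

definition partition_fun :: "nat \<Rightarrow> nat \<Rightarrow> 'p field_fun \<Rightarrow> nat \<Rightarrow> 'p padic" where
  "partition_fun N q h n = (\<Sum>\<sigma>\<in>Conf q (Vn n). weight N h n \<sigma>)"

definition gibbs_n :: "nat \<Rightarrow> nat \<Rightarrow> 'p field_fun \<Rightarrow> nat \<Rightarrow> config \<Rightarrow> 'p padic" where
  "gibbs_n N q h n \<sigma> = 1 / partition_fun N q h n * weight N h n \<sigma>"

definition join :: "nat \<Rightarrow> config \<Rightarrow> config \<Rightarrow> config" where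
  "join n \<sigma> \<omega> = (\<lambda>x. if x \<in> Vn (n - 1) then \<sigma> x else \<omega> x)"

definition compatible :: "nat \<Rightarrow> nat \<Rightarrow> 'p field_fun \<Rightarrow> bool" where
  "compatible N q h \<longleftrightarrow> (\<forall>n\<ge>2. \<forall>\<sigma>\<in>Conf q (Vn (n - 1)).
     (\<Sum>\<omega>\<in>Conf q (Wn n). gibbs_n N q h n (join n \<sigma> \<omega>)) = gibbs_n N q h (n - 1) \<sigma>)"

text \<open>The root lies in no \<open>Vn n\<close>, so configurations live on the vertices other than the root.\<close>

definition Omega :: "nat \<Rightarrow> config set" where
  "Omega q = Conf q (- {tree_root})"

definition cylinder :: "nat \<Rightarrow> nat \<Rightarrow> config \<Rightarrow> config set" where
  "cylinder q n \<sigma> = {\<omega> \<in> Omega q. restrict \<omega> (Vn n) = \<sigma>}"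

definition cylinder_algebra :: "nat \<Rightarrow> config set set" where
  "cylinder_algebra q = {\<Union>(cylinder q n ` B) | n B. n \<ge> 1 \<and> B \<subseteq> Conf q (Vn n)}"

lemma Union_cylinder:
  "\<Union>(cylinder q n ` B) = {\<omega> \<in> Omega q. restrict \<omega> (Vn n) \<in> B}"
  by (auto simp: cylinder_def)

lemma restrict_Omega: "\<omega> \<in> Omega q \<Longrightarrow> restrict \<omega> (Vn n) \<in> Conf q (Vn n)"
  by (auto simp: Omega_def Conf_def Vn_eq PiE_def extensional_def Pi_def)

lemma cylinder_algebraE:
  assumes "A \<in> cylinder_algebra q"
  obtains n where "\<And>m. m \<ge> n \<Longrightarrow> \<exists>B \<subseteq> Conf q (Vn m). A = \<Union>(cylinder q m ` B)"
proof -
  obtain n B where n: "n \<ge> 1" "B \<subseteq> Conf q (Vn n)" "A = \<Union>(cylinder q n ` B)"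
    using assms by (auto simp: cylinder_algebra_def)
  have "\<exists>C \<subseteq> Conf q (Vn m). A = \<Union>(cylinder q m ` C)" if "m \<ge> n" for m
  proof (intro exI conjI)
    let ?C = "{\<sigma> \<in> Conf q (Vn m). restrict \<sigma> (Vn n) \<in> B}"
    have "Vn n \<subseteq> Vn m" using that by (auto simp: Vn_eq)
    hence "restrict (restrict \<omega> (Vn m)) (Vn n) = restrict \<omega> (Vn n)" for \<omega> :: config
      by (simp add: Int_absorb1)
    thus "A = \<Union>(cylinder q m ` ?C)"
      using n restrict_Omega by (auto simp: Union_cylinder)
  qed auto
  thus ?thesis using that by blast
qed

lemma algebra_cylinder_algebra: "algebra (Omega q) (cylinder_algebra q)"
  unfolding algebra_iff_Un
proof (intro conjI ballI)
  show "cylinder_algebra q \<subseteq> Pow (Omega q)"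
    by (auto simp: cylinder_algebra_def cylinder_def)
  show "{} \<in> cylinder_algebra q"
    unfolding cylinder_algebra_def by (auto intro!: exI[of _ 1] exI[of _ "{}"])
next
  fix A assume "A \<in> cylinder_algebra q"
  then obtain n B where n: "n \<ge> 1" "B \<subseteq> Conf q (Vn n)" "A = \<Union>(cylinder q n ` B)"
    by (auto simp: cylinder_algebra_def)
  hence "Omega q - A = \<Union>(cylinder q n ` (Conf q (Vn n) - B))"
    using restrict_Omega by (auto simp: Union_cylinder)
  thus "Omega q - A \<in> cylinder_algebra q"
    using n unfolding cylinder_algebra_def by blast
next
  fix A A' assume A: "A \<in> cylinder_algebra q" and A': "A' \<in> cylinder_algebra q"
  obtain n where n: "\<And>m. m \<ge> n \<Longrightarrow> \<exists>B \<subseteq> Conf q (Vn m). A = \<Union>(cylinder q m ` B)"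
    using cylinder_algebraE[OF A] by blast
  obtain n' where n': "\<And>m. m \<ge> n' \<Longrightarrow> \<exists>B \<subseteq> Conf q (Vn m). A' = \<Union>(cylinder q m ` B)"
    using cylinder_algebraE[OF A'] by blast
  define m where "m = max 1 (max n n')"
  have "m \<ge> n" "m \<ge> n'" by (auto simp: m_def)
  then obtain B B' where "B \<subseteq> Conf q (Vn m)" "A = \<Union>(cylinder q m ` B)"
      "B' \<subseteq> Conf q (Vn m)" "A' = \<Union>(cylinder q m ` B')"
    using n[of m] n'[of m] by blast
  hence "A \<union> A' = \<Union>(cylinder q m ` (B \<union> B'))" "B \<union> B' \<subseteq> Conf q (Vn m)" by auto
  moreover have "m \<ge> 1" by (simp add: m_def)
  ultimately show "A \<union> A' \<in> cylinder_algebra q"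
    unfolding cylinder_algebra_def by blast
qed

text \<open>Requiring \<open>\<mu>\<close> to be undefined off the algebra makes a measure a single HOL function.\<close>

definition padic_prob_measure :: "nat \<Rightarrow> (config set \<Rightarrow> 'p padic) \<Rightarrow> bool" where
  "padic_prob_measure q \<mu> \<longleftrightarrow>
     \<mu> \<in> extensional (cylinder_algebra q) \<and> additive (cylinder_algebra q) \<mu> \<and> \<mu> (Omega q) = 1"

definition quasi_gibbs ::
  "nat \<Rightarrow> nat \<Rightarrow> 'p field_fun \<Rightarrow> (config set \<Rightarrow> 'p padic) \<Rightarrow> bool" where
  "quasi_gibbs N q h \<mu> \<longleftrightarrow>
     (\<forall>x. x \<noteq> tree_root \<longrightarrow> h x 0 \<noteq> 0) \<and>
     (\<forall>n\<ge>1. partition_fun N q h n \<noteq> 0) \<and>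
     compatible N q h \<and>
     padic_prob_measure q \<mu> \<and>
     (\<forall>n\<ge>1. \<forall>\<sigma>\<in>Conf q (Vn n). \<mu> (cylinder q n \<sigma>) = gibbs_n N q h n \<sigma>)"

lemma finite_Conf_V: "finite (Conf q (Vn n))"
proof -
  have "Vn n \<subseteq> {xs. set xs \<subseteq> UNIV \<and> length xs \<le> n}" by (auto simp: Vn_eq)
  hence "finite (Vn n)" by (rule finite_subset) (rule finite_lists_length_le, simp)
  thus ?thesis unfolding Conf_def by (intro finite_PiE) auto
qed

lemma quasi_gibbs_unique:
  fixes \<mu> \<nu> :: "config set \<Rightarrow> 'p padic"
  assumes "quasi_gibbs N q h \<mu>" "quasi_gibbs N q h \<nu>"
  shows "\<mu> = \<nu>"
proof (rule extensionalityI)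
  show "\<mu> \<in> extensional (cylinder_algebra q)" "\<nu> \<in> extensional (cylinder_algebra q)"
    using assms by (auto simp: quasi_gibbs_def padic_prob_measure_def)
next
  interpret algebra "Omega q" "cylinder_algebra q" by (rule algebra_cylinder_algebra)
  have val: "\<mu>' (\<Union>(cylinder q n ` B)) = (\<Sum>\<sigma>\<in>B. gibbs_n N q h n \<sigma>)"
    if \<mu>': "quasi_gibbs N q h \<mu>'" and n: "n \<ge> 1" and B: "B \<subseteq> Conf q (Vn n)"
    for \<mu>' :: "config set \<Rightarrow> 'p padic" and n B
  proof -
    have add: "additive (cylinder_algebra q) \<mu>'"
      using \<mu>' by (simp add: quasi_gibbs_def padic_prob_measure_def)
    have "finite B" using B finite_Conf_V by (rule finite_subset)
    thus ?thesis using B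
    proof (induction rule: finite_induct)
      case empty
      have "\<mu>' ({} \<union> {}) = \<mu>' {} + \<mu>' {}" by (rule additiveD[OF add]) auto
      hence "\<mu>' {} + 0 = \<mu>' {} + \<mu>' {}" by simp
      hence "\<mu>' {} = 0" by (simp only: add_left_cancel)
      thus ?case by simp
    next
      case (insert \<sigma> B)
      have mem: "C \<subseteq> Conf q (Vn n) \<Longrightarrow> \<Union>(cylinder q n ` C) \<in> cylinder_algebra q" for C
        using n unfolding cylinder_algebra_def by blast
      have "\<mu>' (cylinder q n \<sigma> \<union> \<Union>(cylinder q n ` B)) =
          \<mu>' (cylinder q n \<sigma>) + \<mu>' (\<Union>(cylinder q n ` B))"
        using insert mem[of "{\<sigma>}"] mem[of B]
        by (intro additiveD[OF add]) (auto simp: cylinder_def)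
      moreover have "\<mu>' (cylinder q n \<sigma>) = gibbs_n N q h n \<sigma>"
        using \<mu>' n insert.prems by (auto simp: quasi_gibbs_def)
      ultimately show ?case using insert by simp
    qed
  qed
  fix A assume "A \<in> cylinder_algebra q"
  then obtain n B where "n \<ge> 1" "B \<subseteq> Conf q (Vn n)" "A = \<Union>(cylinder q n ` B)"
    by (auto simp: cylinder_algebra_def)
  thus "\<mu> A = \<nu> A" using val[OF assms(1)] val[OF assms(2)] by simp
qed

definition gibbs_measure ::
  "nat \<Rightarrow> nat \<Rightarrow> 'p field_fun \<Rightarrow> config set \<Rightarrow> 'p padic" where
  "gibbs_measure N q h = (THE \<mu>. quasi_gibbs N q h \<mu>)"

lemma gibbs_measure_eq: "quasi_gibbs N q h \<mu> \<Longrightarrow> gibbs_measure N q h = \<mu>"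
  unfolding gibbs_measure_def by (blast intro: the_equality quasi_gibbs_unique)

definition padic_bounded :: "nat \<Rightarrow> (config set \<Rightarrow> 'p padic) \<Rightarrow> bool" where
  "padic_bounded q \<mu> \<longleftrightarrow> bdd_above ((\<lambda>A. padic_abs (\<mu> A)) ` cylinder_algebra q)"

definition phase_transition_pair ::
  "nat \<Rightarrow> nat \<Rightarrow> (config set \<Rightarrow> 'p padic) \<Rightarrow> (config set \<Rightarrow> 'p padic) \<Rightarrow> bool" where
  "phase_transition_pair N q \<mu> \<nu> \<longleftrightarrow>
     (\<exists>h. quasi_gibbs N q h \<mu>) \<and> (\<exists>h. quasi_gibbs N q h \<nu>) \<and>
     padic_bounded q \<mu> \<and> \<not> padic_bounded q \<nu>"

definition strong_phase_transition :: "'p itself \<Rightarrow> nat \<Rightarrow> nat \<Rightarrow> bool" where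
  "strong_phase_transition TYPE('p) N q \<longleftrightarrow>
     (\<exists>\<mu> \<nu> :: config set \<Rightarrow> 'p padic.
        phase_transition_pair N q \<mu> \<nu> \<and>
        (\<exists>A. (\<forall>n\<ge>1. A n \<in> Conf q (Vn n)) \<and>
             (\<lambda>n. padic_abs (\<mu> (cylinder q n (A n)))) \<longlonglongrightarrow> 0 \<and>
             filterlim (\<lambda>n. padic_abs (\<nu> (cylinder q n (A n)))) at_top sequentially))"

text \<open>The vectors \<open>(h\<^sub>0, \<dots>, h\<^sub>q)\<close> with \<open>h\<^sub>0 \<noteq> 0\<close>, \<open>h\<^sub>m / h\<^sub>0 = x\<close> and all other ratios equal to one.\<close>

definition ti_vector :: "nat \<Rightarrow> nat \<Rightarrow> 'p padic \<Rightarrow> (nat \<Rightarrow> 'p padic) \<Rightarrow> bool" where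
  "ti_vector q m x h \<longleftrightarrow>
     h 0 \<noteq> 0 \<and> h m / h 0 = x \<and> (\<forall>j\<in>{1..q} - {m}. h j / h 0 = 1)"

definition labelled_roots ::
  "nat \<Rightarrow> 'p padic \<Rightarrow> 'p padic \<Rightarrow> 'p padic \<Rightarrow> bool" where
  "labelled_roots q \<theta> x1 x2 \<longleftrightarrow>
     (\<forall>x\<in>{x1, x2}. x\<^sup>2 + (2 * \<theta> - \<theta>\<^sup>2 + 2 * of_nat q - 1) * x + (of_nat q)\<^sup>2 = 0) \<and>
     padic_abs x1 = (padic_abs (of_nat q :: 'p padic))\<^sup>2 \<and> padic_abs x2 = 1"

end

theory Submission
  imports Defs
begin

text \<open>
  Put \<open>D = x + \<theta> + q - 1\<close>. Summing out the last level of the tree multiplies a weight by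
  \<open>c = h\<^sub>0 D\<^sup>2\<close> for every vertex of the previous level, as \<open>x\<close> is a fixed point of
  \<open>f\<close>. Hence the measures are compatible, with \<open>Z\<^sub>n = (h\<^sub>0 (x + q))\<^sup>2 c ^ (2 ^ n - 2)\<close>. For
  \<open>x = x\<^sub>1\<close> the number \<open>D\<close> is a unit, so \<open>|\<mu>\<^sub>1|\<close> is at most \<open>|q| ^ (- 2)\<close> on
  cylinders, hence everywhere by the ultrametric inequality. For \<open>x\<^sub>0\<close> and \<open>x\<^sub>2\<close>, which are units,
  \<open>|D| = |q| < 1\<close>. The configuration that alternates between \<open>m\<close> and \<open>0\<close> from level to level,
  with \<open>m\<close> on the last one, has energy zero, so its measure has absolute value
  \<open>(|x| / |D|\<^sup>2) ^ (2 ^ n)\<close> up to a constant; this tends to zero for \<open>x\<^sub>1\<close> and to infinity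
  for \<open>x\<^sub>0\<close> and \<open>x\<^sub>2\<close>.
\<close>

section \<open>The p-adic absolute value\<close>

text \<open>Reduces claims about \<open>'p padic\<close> to Cauchy sequences of rationals; the
  multiplicative and ultrametric laws of \<open>rat_pabs\<close> then pass to the limit.\<close>

lemma padic_repr_cases:
  fixes x :: "'p padic"
  obtains X where "padic_Cauchy (pchar TYPE('p)) X" "x = padic_of X"
proof -
  have "padic_rel (pchar TYPE('p)) (padic_rep x) (padic_rep x)" "padic_of (padic_rep x) = x"
    using Quotient_rep_reflp[OF Quotient_padic] Quotient_abs_rep[OF Quotient_padic] by metis+
  thus ?thesis using that by (metis padic_rel_def)
qed

lemma padic_abs_LIMSEQ:
  assumes "padic_Cauchy (pchar TYPE('p)) X"
  shows "(\<lambda>n. rat_pabs (pchar TYPE('p)) (X n)) \<longlonglongrightarrow> padic_abs (padic_of X :: 'p padic)"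
  using padic_Cauchy_abs_convergent[OF prime_pchar assms]
  by (simp add: padic_abs.abs_eq padic_rel_refl[OF prime_pchar assms] convergent_LIMSEQ_iff)

lemma padic_abs_nonneg [simp]: "padic_abs (x :: 'p padic) \<ge> 0"
proof (cases x rule: padic_repr_cases)
  case (1 X)
  show ?thesis using padic_abs_LIMSEQ[OF 1(1)]
    unfolding 1(2) by (rule LIMSEQ_le_const) (auto simp: rat_pabs_nonneg[OF prime_pchar])
qed

lemma padic_abs_mult: "padic_abs (x * y :: 'p padic) = padic_abs x * padic_abs y"
proof (cases x rule: padic_repr_cases, cases y rule: padic_repr_cases)
  fix X Y assume X: "padic_Cauchy (pchar TYPE('p)) X" "x = padic_of X"
    and Y: "padic_Cauchy (pchar TYPE('p)) Y" "y = padic_of Y"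
  have "x * y = padic_of (\<lambda>n. X n * Y n)"
    using X Y by (simp add: times_padic.abs_eq padic_rel_refl prime_pchar)
  hence "(\<lambda>n. rat_pabs (pchar TYPE('p)) (X n * Y n)) \<longlonglongrightarrow> padic_abs (x * y)"
    using padic_abs_LIMSEQ[OF padic_Cauchy_mult[OF prime_pchar X(1) Y(1)]] by simp
  moreover have "(\<lambda>n. rat_pabs (pchar TYPE('p)) (X n * Y n)) \<longlonglongrightarrow> padic_abs x * padic_abs y"
    unfolding rat_pabs_mult[OF prime_pchar] X(2) Y(2)
    by (intro tendsto_mult padic_abs_LIMSEQ X Y)
  ultimately show ?thesis by (rule LIMSEQ_unique)
qed

lemma padic_abs_add_le_max: "padic_abs (x + y :: 'p padic) \<le> max (padic_abs x) (padic_abs y)"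
proof (cases x rule: padic_repr_cases, cases y rule: padic_repr_cases)
  fix X Y assume X: "padic_Cauchy (pchar TYPE('p)) X" "x = padic_of X"
    and Y: "padic_Cauchy (pchar TYPE('p)) Y" "y = padic_of Y"
  have "x + y = padic_of (\<lambda>n. X n + Y n)"
    using X Y by (simp add: plus_padic.abs_eq padic_rel_refl prime_pchar)
  hence "(\<lambda>n. rat_pabs (pchar TYPE('p)) (X n + Y n)) \<longlonglongrightarrow> padic_abs (x + y)"
    using padic_abs_LIMSEQ[OF padic_Cauchy_add[OF prime_pchar X(1) Y(1)]] by simp
  moreover have "(\<lambda>n. max (rat_pabs (pchar TYPE('p)) (X n)) (rat_pabs (pchar TYPE('p)) (Y n)))
      \<longlonglongrightarrow> max (padic_abs x) (padic_abs y)"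
    unfolding X(2) Y(2) by (intro tendsto_max padic_abs_LIMSEQ X Y)
  ultimately show ?thesis
    by (rule LIMSEQ_le) (auto intro: rat_pabs_add_le_max[OF prime_pchar])
qed

lemma padic_of_eq_0_iff:
  assumes "padic_Cauchy (pchar TYPE('p)) X"
  shows "(padic_of X :: 'p padic) = 0 \<longleftrightarrow> padic_null (pchar TYPE('p)) X"
proof -
  have "padic_rel (pchar TYPE('p)) X (\<lambda>n. 0) \<longleftrightarrow> (padic_of X :: 'p padic) = padic_of (\<lambda>n. 0)"
    using Quotient_rel[OF Quotient_padic, where ?'p1 = 'p, of X "\<lambda>n. 0"] assms
    by (simp add: padic_rel_refl prime_pchar)
  thus ?thesis using assms by (simp add: zero_padic_def padic_rel_def prime_pchar)
qed

lemma padic_abs_eq_0_iff [simp]: "padic_abs (x :: 'p padic) = 0 \<longleftrightarrow> x = 0"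
proof (cases x rule: padic_repr_cases)
  case (1 X)
  show ?thesis unfolding 1(2) padic_of_eq_0_iff[OF 1(1)] padic_null_def
    using padic_abs_LIMSEQ[OF 1(1)] LIMSEQ_unique by metis
qed

lemma padic_abs_0 [simp]: "padic_abs (0 :: 'p padic) = 0"
  by simp

lemma padic_abs_1 [simp]: "padic_abs (1 :: 'p padic) = 1"
  using padic_abs_mult[of "1 :: 'p padic" 1] padic_abs_eq_0_iff[of "1 :: 'p padic"] by simp

lemma padic_abs_minus [simp]: "padic_abs (- x :: 'p padic) = padic_abs x"
proof -
  have "padic_abs (-1 :: 'p padic) * padic_abs (-1 :: 'p padic) = 1"
    unfolding padic_abs_mult[symmetric] by simp
  hence "padic_abs (-1 :: 'p padic) = 1"
    using padic_abs_nonneg[of "-1 :: 'p padic"] by (metis abs_of_nonneg abs_1 power2_eq_1_iff power2_eq_square abs_minus_cancel)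
  thus ?thesis using padic_abs_mult[of "-1" x] by simp
qed

lemma padic_abs_pos_iff [simp]: "padic_abs (x :: 'p padic) > 0 \<longleftrightarrow> x \<noteq> 0"
  using padic_abs_nonneg[of x] padic_abs_eq_0_iff[of x] by linarith

lemma padic_abs_power: "padic_abs (x ^ n :: 'p padic) = padic_abs x ^ n"
  by (induction n) (simp_all add: padic_abs_mult)

lemma padic_abs_prod: "padic_abs (\<Prod>a\<in>A. f a :: 'p padic) = (\<Prod>a\<in>A. padic_abs (f a))"
  by (induction A rule: infinite_finite_induct) (simp_all add: padic_abs_mult)

lemma padic_abs_divide: "padic_abs (x / y :: 'p padic) = padic_abs x / padic_abs y"
proof (cases "y = 0")
  case False
  thus ?thesis using padic_abs_mult[of "x / y" y] by (simp add: field_simps)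
qed simp

text \<open>As \<open>x = (x + y) - y\<close>, a value of \<open>x + y\<close> smaller than
  \<open>x\<close> would contradict the ultrametric inequality. Used below to read off sizes from a
  dominant summand.\<close>

lemma padic_abs_add_eq:
  assumes "padic_abs y < padic_abs (x :: 'p padic)"
  shows "padic_abs (x + y) = padic_abs x"
  using padic_abs_add_le_max[of x y] padic_abs_add_le_max[of "x + y" "- y"] assms by simp

text \<open>The ultrametric bound is independent of the number of summands, so a bound on single
  cylinders passes unchanged to their finite unions.\<close>

lemma padic_abs_sum_le:
  assumes "finite A" "C \<ge> 0" "\<And>a. a \<in> A \<Longrightarrow> padic_abs (f a :: 'p padic) \<le> C"
  shows "padic_abs (\<Sum>a\<in>A. f a) \<le> C"
  using assms
proof (induction rule: finite_induct)
  case (insert a A)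
  thus ?case using padic_abs_add_le_max[of "f a" "sum f A"] by fastforce
qed simp

lemma padic_abs_of_nat_le_1: "padic_abs (of_nat n :: 'p padic) \<le> 1"
  using padic_abs_sum_le[of "{..<n}" 1 "\<lambda>_. 1 :: 'p padic"] by simp

section \<open>Rational coefficients and the small root of a quadratic\<close>

lemma padic_of_rat_minus: "padic_of_rat (- r) = - (padic_of_rat r :: 'p padic)"
  by transfer (simp add: padic_rel_refl prime_pchar)

lemma padic_of_rat_add: "padic_of_rat (r + s) = (padic_of_rat r + padic_of_rat s :: 'p padic)"
  by transfer (simp add: padic_rel_refl prime_pchar)

lemma padic_of_rat_mult: "padic_of_rat (r * s) = (padic_of_rat r * padic_of_rat s :: 'p padic)"
  by transfer (simp add: padic_rel_refl prime_pchar)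

lemma padic_of_rat_diff: "padic_of_rat (r - s) = (padic_of_rat r - padic_of_rat s :: 'p padic)"
  using padic_of_rat_add[of r "- s"] by (simp add: padic_of_rat_minus)

lemma padic_of_rat_power: "padic_of_rat (r ^ n) = (padic_of_rat r ^ n :: 'p padic)"
  using padic_of_rat_of_nat[of 1, where ?'p = 'p]
  by (induction n) (simp_all add: padic_of_rat_mult)

text \<open>Telescoping takes a maximum instead of a geometric series, so all later terms stay
  within \<open>k ^ n\<close> of the \<open>n\<close>-th one.\<close>

lemma padic_Cauchy_geometric:
  assumes p: "prime p" and k: "0 \<le> k" "k < 1"
    and step: "\<And>n. rat_pabs p (X (Suc n) - X n) \<le> k ^ n"
  shows "padic_Cauchy p X"
proof -
  have far: "rat_pabs p (X (n + d) - X n) \<le> k ^ n" for n d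
  proof (induction d)
    case (Suc d)
    have "rat_pabs p (X (Suc (n + d)) - X (n + d)) \<le> k ^ n"
      using step[of "n + d"] k power_decreasing[of n "n + d" k] by linarith
    thus ?case
      using Suc rat_pabs_add_le_max[OF p, of "X (Suc (n + d)) - X (n + d)" "X (n + d) - X n"] by simp
  qed (use p k in simp)
  show ?thesis unfolding padic_Cauchy_def
  proof (intro allI impI)
    fix e :: real assume "e > 0"
    then obtain N where N: "k ^ N < e" using k real_arch_pow_inv by blast
    have "rat_pabs p (X m - X n) < e" if "m \<ge> N" "n \<ge> N" for m n
      using far[of N "m - N"] far[of N "n - N"] that N rat_pabs_commute[OF p, of "X n" "X N"]
        rat_pabs_add_le_max[OF p, of "X m - X N" "X N - X n"] by simp
    thus "\<exists>k. \<forall>m\<ge>k. \<forall>n\<ge>k. rat_pabs p (X m - X n) < e" by blast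
  qed
qed

text \<open>The root is the fixed point of the contraction \<open>x \<mapsto> - (x\<^sup>2 + c) / b\<close> of the disc of radius \<open>|c|\<close>.\<close>

lemma padic_small_root_quadratic:
  fixes b c :: rat
  assumes b: "rat_pabs (pchar TYPE('p)) b = 1" and c: "rat_pabs (pchar TYPE('p)) c < 1"
  obtains x :: "'p padic"
  where "x\<^sup>2 + padic_of_rat b * x + padic_of_rat c = 0" "padic_abs x \<le> padic_abs (padic_of_rat c :: 'p padic)"
proof -
  define p where "p = pchar TYPE('p)"
  have p: "prime p" by (simp add: p_def prime_pchar)
  note b = b[folded p_def] and c = c[folded p_def]
  define k where "k = rat_pabs p c"
  have k: "0 \<le> k" "k < 1" using c rat_pabs_nonneg[OF p] by (auto simp: k_def)
  define X where "X = rec_nat 0 (\<lambda>_ x. - (inverse b * (x * x + c)))"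
  have X0: "X 0 = 0" and XS: "X (Suc n) = - (inverse b * (X n * X n + c))" for n
    by (simp_all add: X_def)
  have b0: "b \<noteq> 0" using b by auto
  have small: "rat_pabs p (X n) \<le> k" for n
  proof (induction n)
    case (Suc n)
    have "rat_pabs p (X n * X n) \<le> k * 1"
      unfolding rat_pabs_mult[OF p] using Suc k by (intro mult_mono) (auto simp: rat_pabs_nonneg[OF p])
    hence "rat_pabs p (X n * X n + c) \<le> k"
      using rat_pabs_add_le_max[OF p, of "X n * X n" c] by (simp add: k_def)
    thus ?case by (simp only: XS rat_pabs_minus[OF p] rat_pabs_mult[OF p] rat_pabs_inverse[OF p] b inverse_1 mult_1)
  qed (use k in \<open>simp add: X0 p\<close>)
  \<comment> \<open>In consecutive increments \<open>c\<close> cancels and the difference of squares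
    factors; \<open>X (Suc n) + X n\<close> has size at most \<open>k\<close> and \<open>b\<close>
    is a unit.\<close>
  have step: "rat_pabs p (X (Suc n) - X n) \<le> k ^ n" for n
  proof (induction n)
    case (Suc n)
    have "X (Suc (Suc n)) - X (Suc n) = - (inverse b * ((X (Suc n) - X n) * (X (Suc n) + X n)))"
      unfolding XS[of "Suc n"] by (subst (3) XS) (simp add: algebra_simps)
    hence "rat_pabs p (X (Suc (Suc n)) - X (Suc n)) = rat_pabs p (X (Suc n) - X n) * rat_pabs p (X (Suc n) + X n)"
      by (simp only: rat_pabs_minus[OF p] rat_pabs_mult[OF p] rat_pabs_inverse[OF p] b inverse_1 mult_1)
    also have "\<dots> \<le> k ^ n * k"
      using rat_pabs_add_le_max[OF p, of "X (Suc n)" "X n"] small[of n] small[of "Suc n"] Suc k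
      by (intro mult_mono) (auto simp: rat_pabs_nonneg[OF p])
    finally show ?case by (simp add: mult.commute)
  qed (use small[of 1] k in \<open>simp add: X0\<close>)
  have CX: "padic_Cauchy p X" by (rule padic_Cauchy_geometric[OF p k step])
  note C = padic_Cauchy_mult[OF p] padic_Cauchy_add[OF p] padic_Cauchy_const[OF p] CX
  note R = padic_rel_refl[OF p]
  define x :: "'p padic" where "x = padic_of X"
  have "x\<^sup>2 + padic_of_rat b * x + padic_of_rat c = padic_of (\<lambda>n. X n * X n + b * X n + c)"
    unfolding power2_eq_square x_def padic_of_rat_def
    by (simp add: times_padic.abs_eq plus_padic.abs_eq R[unfolded p_def] C[unfolded p_def])
  also have "\<dots> = 0"
  proof (subst padic_of_eq_0_iff)
    show "padic_Cauchy (pchar TYPE('p)) (\<lambda>n. X n * X n + b * X n + c)"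
      using C by (simp add: p_def)
    \<comment> \<open>The value of the quadratic at \<open>X n\<close> is \<open>- b\<close> times
      the next increment, so it tends to zero with the increments.\<close>
    have le: "rat_pabs p (X n * X n + b * X n + c) \<le> k ^ n" for n
    proof -
      have "b * X (Suc n) = - (b * inverse b) * (X n * X n + c)"
        unfolding XS by (simp only: mult_minus_right mult_minus_left mult.assoc)
      also have "b * inverse b = 1" using b0 by simp
      finally have "- (b * (X (Suc n) - X n)) = X n * X n + b * X n + c"
        unfolding right_diff_distrib by simp
      hence "X n * X n + b * X n + c = - (b * (X (Suc n) - X n))" by (rule sym)
      thus ?thesis using step[of n] b by (simp only: rat_pabs_minus[OF p] rat_pabs_mult[OF p] mult_1)
    qed
    have "(\<lambda>n. rat_pabs p (X n * X n + b * X n + c)) \<longlonglongrightarrow> 0"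
    proof (rule tendsto_sandwich[where f = "\<lambda>_. 0" and h = "\<lambda>n. k ^ n"])
      show "(\<lambda>n. k ^ n) \<longlonglongrightarrow> 0" using k by (intro LIMSEQ_realpow_zero)
      show "\<forall>\<^sub>F n in sequentially. 0 \<le> rat_pabs p (X n * X n + b * X n + c)"
        by (intro always_eventually allI rat_pabs_nonneg[OF p])
      show "\<forall>\<^sub>F n in sequentially. rat_pabs p (X n * X n + b * X n + c) \<le> k ^ n"
        by (intro always_eventually allI le)
    qed (rule tendsto_const)
    thus "padic_null (pchar TYPE('p)) (\<lambda>n. X n * X n + b * X n + c)"
      unfolding padic_null_def p_def .
  qed
  finally have root: "x\<^sup>2 + padic_of_rat b * x + padic_of_rat c = 0" .
  have "padic_abs x \<le> k"
    unfolding x_def by (rule LIMSEQ_le_const2[OF padic_abs_LIMSEQ[OF CX[unfolded p_def]]])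
      (use small in \<open>auto simp: p_def\<close>)
  with root show ?thesis using that by (simp add: padic_abs_of_rat k_def p_def)
qed

section \<open>Measures on the cylinder algebra\<close>

lemma finite_Wn [simp]: "finite (Wn n)"
  using finite_lists_length_eq[of "UNIV :: bool set" n] by (simp add: Wn_eq)

lemma card_Wn: "card (Wn n) = 2 ^ n"
  using card_lists_length_eq[of "UNIV :: bool set" n] by (simp add: Wn_eq)

lemma Vn_Suc: "Vn (Suc n) = Vn n \<union> Wn (Suc n)" and Vn_Wn_disjoint: "Vn n \<inter> Wn (Suc n) = {}"
  by (auto simp: Vn_eq Wn_eq)

lemma restrict_join: "\<sigma> \<in> Conf q (Vn n) \<Longrightarrow> restrict (join (Suc n) \<sigma> \<omega>) (Vn n) = \<sigma>"
  by (auto simp: Conf_def join_def fun_eq_iff restrict_def PiE_def extensional_def)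

text \<open>Restricting to \<open>Vn n\<close> and to the new level splits a configuration, and
  \<open>join\<close> inverts the splitting.\<close>

lemma sum_Conf_Vn_Suc:
  "(\<Sum>\<tau>\<in>Conf q (Vn (Suc n)). f \<tau>) =
   (\<Sum>\<sigma>\<in>Conf q (Vn n). \<Sum>\<omega>\<in>Conf q (Wn (Suc n)). f (join (Suc n) \<sigma> \<omega>))"
proof -
  have "(\<Sum>\<sigma>\<in>Conf q (Vn n). \<Sum>\<omega>\<in>Conf q (Wn (Suc n)). f (join (Suc n) \<sigma> \<omega>)) =
      (\<Sum>(\<sigma>, \<omega>)\<in>Conf q (Vn n) \<times> Conf q (Wn (Suc n)). f (join (Suc n) \<sigma> \<omega>))"
    by (rule sum.cartesian_product)
  also have "\<dots> = (\<Sum>\<tau>\<in>Conf q (Vn (Suc n)). f \<tau>)"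
  proof (rule sum.reindex_bij_witness)
    fix a assume "a \<in> Conf q (Vn n) \<times> Conf q (Wn (Suc n))"
    then obtain \<sigma> \<omega> where a: "a = (\<sigma>, \<omega>)" "\<sigma> \<in> Conf q (Vn n)" "\<omega> \<in> Conf q (Wn (Suc n))" by auto
    have "restrict (join (Suc n) \<sigma> \<omega>) (Wn (Suc n)) = \<omega>"
      using a(3) Vn_Wn_disjoint[of n]
      by (auto simp: Conf_def join_def fun_eq_iff restrict_def PiE_def extensional_def)
    thus "(\<lambda>\<tau>. (restrict \<tau> (Vn n), restrict \<tau> (Wn (Suc n)))) ((\<lambda>(\<sigma>, \<omega>). join (Suc n) \<sigma> \<omega>) a) = a"
      using a by (simp add: restrict_join)
    show "(\<lambda>(\<sigma>, \<omega>). join (Suc n) \<sigma> \<omega>) a \<in> Conf q (Vn (Suc n))"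
      using a by (auto simp: Conf_def join_def Vn_Suc PiE_def extensional_def Pi_def)
    show "f ((\<lambda>(\<sigma>, \<omega>). join (Suc n) \<sigma> \<omega>) a) = (case a of (\<sigma>, \<omega>) \<Rightarrow> f (join (Suc n) \<sigma> \<omega>))"
      using a by simp
  next
    fix \<tau> assume "\<tau> \<in> Conf q (Vn (Suc n))"
    thus "(\<lambda>(\<sigma>, \<omega>). join (Suc n) \<sigma> \<omega>) ((\<lambda>\<tau>. (restrict \<tau> (Vn n), restrict \<tau> (Wn (Suc n)))) \<tau>) = \<tau>"
      and "(\<lambda>\<tau>. (restrict \<tau> (Vn n), restrict \<tau> (Wn (Suc n)))) \<tau> \<in> Conf q (Vn n) \<times> Conf q (Wn (Suc n))"
      by (auto simp: Conf_def join_def Vn_Suc PiE_def extensional_def Pi_def fun_eq_iff)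
  qed
  finally show ?thesis by simp
qed

lemma cylinder_nonempty:
  assumes "\<sigma> \<in> Conf q (Vn n)"
  shows "cylinder q n \<sigma> \<noteq> {}"
proof -
  \<comment> \<open>Spin 0 is an arbitrary choice off \<open>Vn n\<close>; the root must get
    \<open>undefined\<close>, since members of \<open>Omega\<close> are extensional on the other
    vertices.\<close>
  define \<omega> where "\<omega> = (\<lambda>x. if x \<in> Vn n then \<sigma> x else if x = tree_root then undefined else 0)"
  have "\<omega> \<in> cylinder q n \<sigma>"
    using assms
    by (auto simp: \<omega>_def cylinder_def Omega_def Conf_def PiE_def extensional_def Pi_def Vn_eq fun_eq_iff restrict_def)
  thus ?thesis by blast
qed

text \<open>Cylinders are nonempty and each member determines its index, so at a fixed level a union
  of cylinders determines its index set.\<close>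

lemma cylinder_Union_subset_iff:
  assumes "B \<subseteq> Conf q (Vn n)"
  shows "\<Union>(cylinder q n ` B) \<subseteq> \<Union>(cylinder q n ` C) \<longleftrightarrow> B \<subseteq> C"
proof
  assume sub: "\<Union>(cylinder q n ` B) \<subseteq> \<Union>(cylinder q n ` C)"
  show "B \<subseteq> C"
  proof
    fix \<sigma> assume \<sigma>: "\<sigma> \<in> B"
    then obtain \<omega> where "\<omega> \<in> cylinder q n \<sigma>" using cylinder_nonempty assms by blast
    with \<sigma> sub show "\<sigma> \<in> C" by (auto simp: cylinder_def)
  qed
qed auto

text \<open>The description is meaningful only for compatible families, for which the sum does not
  depend on the level \<open>n\<close> at which the set is represented.\<close>

definition cylinder_extension :: "nat \<Rightarrow> (nat \<Rightarrow> config \<Rightarrow> 'p padic) \<Rightarrow> config set \<Rightarrow> 'p padic" where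
  "cylinder_extension q g = restrict (\<lambda>A. THE v. \<exists>n\<ge>1. \<exists>B\<subseteq>Conf q (Vn n).
     A = \<Union>(cylinder q n ` B) \<and> v = (\<Sum>\<sigma>\<in>B. g n \<sigma>)) (cylinder_algebra q)"

section \<open>Well-definedness and additivity of the extension\<close>

context
  fixes q :: nat and g :: "nat \<Rightarrow> config \<Rightarrow> 'p padic"
  assumes compat: "\<And>n \<sigma>. n \<ge> 1 \<Longrightarrow> \<sigma> \<in> Conf q (Vn n) \<Longrightarrow>
    (\<Sum>\<omega>\<in>Conf q (Wn (Suc n)). g (Suc n) (join (Suc n) \<sigma> \<omega>)) = g n \<sigma>"
begin

text \<open>Going up one level replaces each configuration by all its extensions; compatibility says
  that this preserves the sum.\<close>

lemma refine_cylinder_Union: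
  assumes "n \<ge> 1" "B \<subseteq> Conf q (Vn n)"
  shows "\<exists>C\<subseteq>Conf q (Vn (n + k)). \<Union>(cylinder q n ` B) = \<Union>(cylinder q (n + k) ` C) \<and>
    (\<Sum>\<sigma>\<in>B. g n \<sigma>) = (\<Sum>\<sigma>\<in>C. g (n + k) \<sigma>)"
proof (induction k)
  case 0
  show ?case using assms by (intro exI[of _ B]) simp
next
  case (Suc k)
  define m where "m = n + k"
  obtain C where C: "C \<subseteq> Conf q (Vn m)" "\<Union>(cylinder q n ` B) = \<Union>(cylinder q m ` C)"
    "(\<Sum>\<sigma>\<in>B. g n \<sigma>) = (\<Sum>\<sigma>\<in>C. g m \<sigma>)" using Suc by (auto simp: m_def)
  define D where "D = {\<tau> \<in> Conf q (Vn (Suc m)). restrict \<tau> (Vn m) \<in> C}"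
  have "restrict (restrict \<omega> (Vn (Suc m))) (Vn m) = restrict \<omega> (Vn m)" for \<omega> :: config
    by (simp add: Vn_Suc Int_absorb1)
  hence U: "\<Union>(cylinder q m ` C) = \<Union>(cylinder q (Suc m) ` D)"
    using restrict_Omega by (auto simp: Union_cylinder D_def)
  have "(\<Sum>\<tau>\<in>D. g (Suc m) \<tau>) =
      (\<Sum>\<tau>\<in>Conf q (Vn (Suc m)). if restrict \<tau> (Vn m) \<in> C then g (Suc m) \<tau> else 0)"
    unfolding D_def by (intro sum.inter_filter finite_Conf_V)
  also have "\<dots> = (\<Sum>\<sigma>\<in>Conf q (Vn m). if \<sigma> \<in> C then
      \<Sum>\<omega>\<in>Conf q (Wn (Suc m)). g (Suc m) (join (Suc m) \<sigma> \<omega>) else 0)"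
    unfolding sum_Conf_Vn_Suc by (intro sum.cong refl) (auto simp: restrict_join)
  also have "\<dots> = (\<Sum>\<sigma>\<in>Conf q (Vn m). if \<sigma> \<in> C then g m \<sigma> else 0)"
    using assms(1) by (intro sum.cong refl) (simp add: compat m_def)
  also have "\<dots> = (\<Sum>\<sigma>\<in>C. g m \<sigma>)"
    using C(1) finite_Conf_V[of q m] by (simp add: sum.inter_restrict[symmetric] Int_absorb1)
  finally have "(\<Sum>\<sigma>\<in>B. g n \<sigma>) = (\<Sum>\<tau>\<in>D. g (Suc m) \<tau>)" using C(3) by simp
  moreover have "D \<subseteq> Conf q (Vn (Suc m))" by (auto simp: D_def)
  ultimately show ?case using U C(2) by (auto simp: m_def)
qed

text \<open>Two descriptions at levels \<open>n\<close> and \<open>n'\<close> are both refined to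
  level \<open>n + n'\<close>. There the index sets coincide, so the sums agree and the definite
  description is unique.\<close>

lemma cylinder_extension_Union:
  assumes n: "n \<ge> 1" "B \<subseteq> Conf q (Vn n)"
  shows "cylinder_extension q g (\<Union>(cylinder q n ` B)) = (\<Sum>\<sigma>\<in>B. g n \<sigma>)"
proof -
  have "(\<Sum>\<sigma>\<in>B'. g n' \<sigma>) = (\<Sum>\<sigma>\<in>B. g n \<sigma>)"
    if n': "n' \<ge> 1" "B' \<subseteq> Conf q (Vn n')" and U: "\<Union>(cylinder q n ` B) = \<Union>(cylinder q n' ` B')" for n' B'
  proof -
    obtain C where C: "C \<subseteq> Conf q (Vn (n + n'))" "\<Union>(cylinder q n ` B) = \<Union>(cylinder q (n + n') ` C)"
      "(\<Sum>\<sigma>\<in>B. g n \<sigma>) = (\<Sum>\<sigma>\<in>C. g (n + n') \<sigma>)" using refine_cylinder_Union[OF n] by metis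
    obtain C' where C': "C' \<subseteq> Conf q (Vn (n + n'))" "\<Union>(cylinder q n' ` B') = \<Union>(cylinder q (n + n') ` C')"
      "(\<Sum>\<sigma>\<in>B'. g n' \<sigma>) = (\<Sum>\<sigma>\<in>C'. g (n + n') \<sigma>)" using refine_cylinder_Union[OF n'] by (metis add.commute)
    have "C = C'"
      using cylinder_Union_subset_iff[OF C(1), of C'] cylinder_Union_subset_iff[OF C'(1), of C] U C(2) C'(2) by auto
    thus ?thesis using C C' by simp
  qed
  hence "(THE v. \<exists>n'\<ge>1. \<exists>B'\<subseteq>Conf q (Vn n'). \<Union>(cylinder q n ` B) = \<Union>(cylinder q n' ` B') \<and>
      v = (\<Sum>\<sigma>\<in>B'. g n' \<sigma>)) = (\<Sum>\<sigma>\<in>B. g n \<sigma>)"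
    using n by (intro the_equality) blast+
  moreover have "\<Union>(cylinder q n ` B) \<in> cylinder_algebra q"
    unfolding cylinder_algebra_def using n by blast
  ultimately show ?thesis by (simp only: cylinder_extension_def restrict_apply if_True)
qed

text \<open>At a common level disjoint sets have disjoint index sets, because cylinders are
  nonempty, and the sum splits.\<close>

lemma additive_cylinder_extension: "additive (cylinder_algebra q) (cylinder_extension q g)"
  unfolding additive_def
proof (intro ballI impI)
  fix A A' assume "A \<in> cylinder_algebra q" "A' \<in> cylinder_algebra q" and disj: "A \<inter> A' = {}"
  then obtain n B n' B' where n: "n \<ge> 1" "B \<subseteq> Conf q (Vn n)" "A = \<Union>(cylinder q n ` B)"
    and n': "n' \<ge> 1" "B' \<subseteq> Conf q (Vn n')" "A' = \<Union>(cylinder q n' ` B')"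
    by (auto simp: cylinder_algebra_def)
  define m where "m = n + n'"
  have m: "m \<ge> 1" using n by (simp add: m_def)
  obtain C where C: "C \<subseteq> Conf q (Vn m)" "A = \<Union>(cylinder q m ` C)"
    using refine_cylinder_Union[OF n(1,2)] n(3) unfolding m_def by metis
  obtain C' where C': "C' \<subseteq> Conf q (Vn m)" "A' = \<Union>(cylinder q m ` C')"
    using refine_cylinder_Union[OF n'(1,2)] n'(3) unfolding m_def by (metis add.commute)
  have "C \<inter> C' = {}"
  proof (rule ccontr)
    assume "C \<inter> C' \<noteq> {}"
    then obtain \<sigma> where \<sigma>: "\<sigma> \<in> C" "\<sigma> \<in> C'" by blast
    then obtain \<omega> where "\<omega> \<in> cylinder q m \<sigma>" using C(1) cylinder_nonempty by blast
    with \<sigma> C(2) C'(2) disj show False by blast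
  qed
  moreover have "finite C" "finite C'" using C(1) C'(1) finite_Conf_V finite_subset by metis+
  moreover have "A \<union> A' = \<Union>(cylinder q m ` (C \<union> C'))" using C C' by auto
  ultimately show "cylinder_extension q g (A \<union> A') = cylinder_extension q g A + cylinder_extension q g A'"
    using C C' m cylinder_extension_Union[OF m, of "C \<union> C'"] cylinder_extension_Union[OF m, of C]
      cylinder_extension_Union[OF m, of C'] by (simp add: sum.union_disjoint)
qed

end

text \<open>Supplies existence for the definite description in \<open>gibbs_measure\<close>,
  uniqueness being \<open>quasi_gibbs_unique\<close>. The second conclusion evaluates the measure on
  the whole algebra.\<close>

lemma quasi_gibbs_gibbs_measure:
  fixes h :: "'p field_fun"
  assumes h: "\<And>x. x \<noteq> tree_root \<Longrightarrow> h x 0 \<noteq> 0"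
    and Z: "\<And>n. n \<ge> 1 \<Longrightarrow> partition_fun N q h n \<noteq> 0"
    and compat: "compatible N q h"
  shows "quasi_gibbs N q h (gibbs_measure N q h)"
    and "\<And>n B. n \<ge> 1 \<Longrightarrow> B \<subseteq> Conf q (Vn n) \<Longrightarrow>
      gibbs_measure N q h (\<Union>(cylinder q n ` B)) = (\<Sum>\<sigma>\<in>B. gibbs_n N q h n \<sigma>)"
proof -
  define \<mu> where "\<mu> = cylinder_extension q (gibbs_n N q h)"
  have compat': "(\<Sum>\<omega>\<in>Conf q (Wn (Suc n)). gibbs_n N q h (Suc n) (join (Suc n) \<sigma> \<omega>)) = gibbs_n N q h n \<sigma>"
    if "n \<ge> 1" "\<sigma> \<in> Conf q (Vn n)" for n \<sigma>
    using compat[unfolded compatible_def, rule_format, of "Suc n" \<sigma>] that by simp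
  note val = cylinder_extension_Union[OF compat', folded \<mu>_def]
  have "\<mu> (cylinder q n \<sigma>) = gibbs_n N q h n \<sigma>" if "n \<ge> 1" "\<sigma> \<in> Conf q (Vn n)" for n \<sigma>
    using val[of n "{\<sigma>}"] that by simp
  moreover have "\<mu> (Omega q) = 1"
  proof -
    \<comment> \<open>Total mass is computed at level one, where the sum of the weights is the
      partition function itself.\<close>
    have "Omega q = \<Union>(cylinder q 1 ` Conf q (Vn 1))"
      using restrict_Omega by (auto simp: Union_cylinder)
    hence "\<mu> (Omega q) = (\<Sum>\<sigma>\<in>Conf q (Vn 1). gibbs_n N q h 1 \<sigma>)" using val[of 1] by simp
    also have "\<dots> = 1"
      using Z[of 1] by (simp add: gibbs_n_def sum_divide_distrib[symmetric] partition_fun_def)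
    finally show ?thesis .
  qed
  moreover have "additive (cylinder_algebra q) \<mu>"
    unfolding \<mu>_def by (rule additive_cylinder_extension[OF compat'])
  ultimately have "quasi_gibbs N q h \<mu>"
    using h Z compat by (auto simp: quasi_gibbs_def padic_prob_measure_def \<mu>_def cylinder_extension_def)
  hence eq: "gibbs_measure N q h = \<mu>" and "quasi_gibbs N q h (gibbs_measure N q h)"
    using gibbs_measure_eq by auto
  thus "quasi_gibbs N q h (gibbs_measure N q h)" by simp
  show "gibbs_measure N q h (\<Union>(cylinder q n ` B)) = (\<Sum>\<sigma>\<in>B. gibbs_n N q h n \<sigma>)"
    if "n \<ge> 1" "B \<subseteq> Conf q (Vn n)" for n B
    using val that by (simp add: eq)
qed

section \<open>Translation-invariant boundary laws\<close>

lemma Ln_eq: "Ln n = (\<lambda>y. {y, tl y}) ` {y. 2 \<le> length y \<and> length y \<le> n}"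
proof (intro equalityI subsetI)
  fix e assume "e \<in> Ln n"
  then obtain b x where "e = {b # x, x}" "x \<in> Vn n" "b # x \<in> Vn n"
    by (auto simp: Ln_def adj_def insert_commute)
  thus "e \<in> (\<lambda>y. {y, tl y}) ` {y. 2 \<le> length y \<and> length y \<le> n}"
    by (intro image_eqI[of _ _ "b # x"]) (cases x; auto simp: Vn_eq)+
next
  fix e :: "vertex set" assume "e \<in> (\<lambda>y. {y, tl y}) ` {y. 2 \<le> length y \<and> length y \<le> n}"
  then obtain y where y: "e = {y, tl y}" "2 \<le> length y" "length y \<le> n" by auto
  then obtain b x where "y = b # x" by (cases y) auto
  moreover from this y have "x \<noteq> []" by auto
  ultimately have "e = {y, x}" "adj y x" "y \<in> Vn n" "x \<in> Vn n" using y by (auto simp: Vn_eq adj_def)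
  thus "e \<in> Ln n" unfolding Ln_def by blast
qed

text \<open>Each edge is indexed by its endpoint farther from the root, the other endpoint being its
  tail. Lengths start at 2 because the root lies in no \<open>Vn n\<close>.\<close>

lemma hamiltonian_eq:
  "hamiltonian N n \<sigma> = N * (\<Sum>y | 2 \<le> length y \<and> length y \<le> n. if \<sigma> y = \<sigma> (tl y) then 1 else 0)"
proof -
  have "inj_on (\<lambda>y :: vertex. {y, tl y}) {y. 2 \<le> length y \<and> length y \<le> n}"
  proof (rule inj_onI)
    fix y z :: vertex
    assume A: "y \<in> {y. 2 \<le> length y \<and> length y \<le> n}" "z \<in> {y. 2 \<le> length y \<and> length y \<le> n}"
      "{y, tl y} = {z, tl z}"
    show "y = z"
    proof (rule ccontr)
      assume "y \<noteq> z"
      \<comment> \<open>Each vertex would be the parent of the other, so each length would be one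
        less than the other.\<close>
      with A(3) have "y = tl z" "z = tl y" by (auto simp: doubleton_eq_iff)
      hence "length y = length z - 1" "length z = length y - 1" using length_tl by metis+
      moreover have "length y \<ge> 2" using A(1) by simp
      ultimately show False by linarith
    qed
  qed
  thus ?thesis unfolding hamiltonian_def Ln_eq
    by (subst sum.reindex) (auto intro!: arg_cong[where f = "(*) N"] sum.cong)
qed

text \<open>The new edges join the last level to its parents. For \<open>n \<ge> 1\<close> these
  parents lie in \<open>Vn n\<close>, so \<open>join\<close> reads their spins from
  \<sigma>.\<close>

lemma hamiltonian_join:
  assumes "n \<ge> 1"
  shows "hamiltonian N (Suc n) (join (Suc n) \<sigma> \<omega>) =
    hamiltonian N n \<sigma> + (\<Sum>y\<in>Wn (Suc n). if \<omega> y = \<sigma> (tl y) then N else 0)"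
proof -
  let ?\<tau> = "join (Suc n) \<sigma> \<omega>" and ?f = "\<lambda>\<tau> y. if \<tau> y = \<tau> (tl y) then 1 else 0 :: nat"
  let ?E = "{y :: vertex. 2 \<le> length y \<and> length y \<le> n}"
  have fin: "finite ?E"
    by (rule finite_subset[OF _ finite_lists_length_le[of "UNIV :: bool set" n]]) auto
  have disj: "?E \<inter> Wn (Suc n) = {}" by (auto simp: Wn_eq)
  have "{y. 2 \<le> length y \<and> length y \<le> Suc n} = ?E \<union> Wn (Suc n)"
    using assms by (auto simp: Wn_eq)
  hence "hamiltonian N (Suc n) ?\<tau> = N * (sum (?f ?\<tau>) ?E + sum (?f ?\<tau>) (Wn (Suc n)))"
    using fin disj by (simp only: hamiltonian_eq sum.union_disjoint finite_Wn)
  also have "sum (?f ?\<tau>) ?E = sum (?f \<sigma>) ?E"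
  proof (intro sum.cong refl)
    fix y assume "y \<in> ?E"
    hence "y \<in> Vn n" "tl y \<in> Vn n" by (cases y; auto simp: Vn_eq)+
    thus "?f ?\<tau> y = ?f \<sigma> y" by (simp add: join_def)
  qed
  also have "sum (?f ?\<tau>) (Wn (Suc n)) = (\<Sum>y\<in>Wn (Suc n). if \<omega> y = \<sigma> (tl y) then 1 else 0)"
  proof (intro sum.cong refl)
    fix y assume "y \<in> Wn (Suc n)"
    hence "y \<notin> Vn n" "tl y \<in> Vn n" using assms by (cases y; auto simp: Vn_eq Wn_eq)+
    thus "?f ?\<tau> y = (if \<omega> y = \<sigma> (tl y) then 1 else 0)" by (simp add: join_def)
  qed
  finally show ?thesis
    by (simp add: hamiltonian_eq distrib_left sum_distrib_left if_distrib cong: if_cong)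
qed

text \<open>Every vertex of \<open>Wn n\<close> is the tail of exactly two vertices of the next
  level.\<close>

lemma prod_Wn_Suc:
  fixes F :: "vertex \<Rightarrow> 'a :: comm_monoid_mult"
  shows "(\<Prod>y\<in>Wn (Suc n). F (tl y)) = (\<Prod>x\<in>Wn n. F x ^ 2)"
proof -
  have "Wn (Suc n) = Cons True ` Wn n \<union> Cons False ` Wn n"
    by (auto simp: Wn_eq length_Suc_conv)
  hence "(\<Prod>y\<in>Wn (Suc n). F (tl y)) = (\<Prod>y\<in>Cons True ` Wn n. F (tl y)) * (\<Prod>y\<in>Cons False ` Wn n. F (tl y))"
    by (simp only:) (rule prod.union_disjoint, auto)
  also have "\<dots> = (\<Prod>x\<in>Wn n. F x) * (\<Prod>x\<in>Wn n. F x)"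
    by (simp add: prod.reindex)
  finally show ?thesis by (simp add: power2_eq_square prod.distrib)
qed

text \<open>The left-hand side of the law is the result of summing out the
  two successors of a vertex of spin \<open>i\<close>.\<close>

locale ti_boundary_law =
  fixes N q :: nat and u :: "nat \<Rightarrow> 'p padic" and c :: "'p padic"
  assumes law: "\<And>i. i \<le> q \<Longrightarrow>
      ((\<Sum>j\<le>q. u j) + (of_nat (pchar TYPE('p)) ^ N - 1) * u i)\<^sup>2 = c * u i"
    and u0: "u 0 \<noteq> 0" and c0: "c \<noteq> 0" and S0: "(\<Sum>j\<le>q. u j) \<noteq> 0"
begin

text \<open>For fixed \<sigma> the energy of the new edges is a sum over the new vertices, so by
  distributivity the sum over \<omega> factors. The two children of a vertex give the square in the
  law, and each of the \<open>2 ^ n\<close> parents leaves one \<open>c\<close>.\<close>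

lemma sum_weight_join:
  assumes n: "n \<ge> 1" and \<sigma>: "\<sigma> \<in> Conf q (Vn n)"
  shows "(\<Sum>\<omega>\<in>Conf q (Wn (Suc n)). weight N (\<lambda>x. u) (Suc n) (join (Suc n) \<sigma> \<omega>)) =
    c ^ 2 ^ n * weight N (\<lambda>x. u) n \<sigma>"
proof -
  let ?P = "of_nat (pchar TYPE('p)) :: 'p padic" and ?S = "\<Sum>j\<le>q. u j"
  let ?G = "\<lambda>i j. (if j = i then ?P ^ N else 1) * u j"
  have "weight N (\<lambda>x. u) (Suc n) (join (Suc n) \<sigma> \<omega>) =
      ?P ^ hamiltonian N n \<sigma> * (\<Prod>y\<in>Wn (Suc n). ?G (\<sigma> (tl y)) (\<omega> y))" for \<omega>
  proof -
    have "(\<Prod>y\<in>Wn (Suc n). u (join (Suc n) \<sigma> \<omega> y)) = (\<Prod>y\<in>Wn (Suc n). u (\<omega> y))"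
      using Vn_Wn_disjoint[of n] by (intro prod.cong refl) (auto simp: join_def)
    moreover have "?P ^ (\<Sum>y\<in>Wn (Suc n). if \<omega> y = \<sigma> (tl y) then N else 0) =
        (\<Prod>y\<in>Wn (Suc n). if \<omega> y = \<sigma> (tl y) then ?P ^ N else 1)"
      unfolding power_sum by (intro prod.cong) auto
    ultimately show ?thesis
      by (simp add: weight_def hamiltonian_join[OF n] power_add prod.distrib)
  qed
  hence "(\<Sum>\<omega>\<in>Conf q (Wn (Suc n)). weight N (\<lambda>x. u) (Suc n) (join (Suc n) \<sigma> \<omega>)) =
      ?P ^ hamiltonian N n \<sigma> * (\<Sum>\<omega>\<in>Conf q (Wn (Suc n)). \<Prod>y\<in>Wn (Suc n). ?G (\<sigma> (tl y)) (\<omega> y))"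
    by (simp only: sum_distrib_left)
  also have "(\<Sum>\<omega>\<in>Conf q (Wn (Suc n)). \<Prod>y\<in>Wn (Suc n). ?G (\<sigma> (tl y)) (\<omega> y)) =
      (\<Prod>y\<in>Wn (Suc n). \<Sum>j\<in>{0..q}. ?G (\<sigma> (tl y)) j)"
    unfolding Conf_def by (rule prod_sum_PiE[symmetric]) auto
  also have "\<dots> = (\<Prod>x\<in>Wn n. (\<Sum>j\<in>{0..q}. ?G (\<sigma> x) j)\<^sup>2)"
    by (rule prod_Wn_Suc)
  also have "\<dots> = (\<Prod>x\<in>Wn n. c * u (\<sigma> x))"
  proof (intro prod.cong refl)
    fix x assume "x \<in> Wn n"
    hence "x \<in> Vn n" using n by (auto simp: Vn_eq Wn_eq)
    hence i: "\<sigma> x \<le> q" using \<sigma> by (auto simp: Conf_def)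
    \<comment> \<open>\<open>?G\<close> differs from \<open>u\<close> only where the child repeats
      the spin of its parent; this is the correction term of the law.\<close>
    have "(\<Sum>j\<in>{0..q}. ?G (\<sigma> x) j) = (\<Sum>j\<in>{0..q}. u j + (if j = \<sigma> x then (?P ^ N - 1) * u j else 0))"
      by (intro sum.cong) (auto simp: algebra_simps)
    also have "\<dots> = ?S + (?P ^ N - 1) * u (\<sigma> x)"
      using i by (simp add: sum.distrib atLeast0AtMost)
    finally show "(\<Sum>j\<in>{0..q}. ?G (\<sigma> x) j)\<^sup>2 = c * u (\<sigma> x)" using law[OF i] by simp
  qed
  also have "\<dots> = c ^ 2 ^ n * (\<Prod>x\<in>Wn n. u (\<sigma> x))"
    by (simp add: prod.distrib card_Wn)
  finally show ?thesis by (simp add: weight_def mult_ac)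
qed

section \<open>Partition functions and compatibility\<close>

lemma partition_fun_1: "partition_fun N q (\<lambda>x. u) 1 = (\<Sum>j\<le>q. u j)\<^sup>2"
proof -
  have "Vn 1 = Wn 1" by (auto simp: Vn_eq Wn_eq Suc_le_eq le_Suc_eq)
  \<comment> \<open>Without the root there is no edge at level one, so only the boundary product
    remains.\<close>
  moreover have "{y :: vertex. 2 \<le> length y \<and> length y \<le> 1} = {}" by auto
  ultimately have "partition_fun N q (\<lambda>x. u) 1 = (\<Sum>\<omega>\<in>Conf q (Wn 1). \<Prod>y\<in>Wn 1. u (\<omega> y))"
    by (simp only: partition_fun_def weight_def hamiltonian_eq sum.empty mult_0_right power_0 mult_1)
  also have "\<dots> = (\<Prod>y\<in>Wn 1. \<Sum>j\<in>{0..q}. u j)"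
    unfolding Conf_def by (rule prod_sum_PiE[symmetric]) auto
  finally show ?thesis by (simp add: card_Wn atLeast0AtMost)
qed

lemma partition_fun_Suc:
  "n \<ge> 1 \<Longrightarrow> partition_fun N q (\<lambda>x. u) (Suc n) = c ^ 2 ^ n * partition_fun N q (\<lambda>x. u) n"
  by (simp add: partition_fun_def sum_Conf_Vn_Suc sum_weight_join sum_distrib_left)

text \<open>The exponent is \<open>2 + 4 + ... + 2 ^ (n - 1)\<close>: one \<open>c\<close> for every
  vertex of the levels 1 to \<open>n - 1\<close>.\<close>

lemma partition_fun_eq:
  "n \<ge> 1 \<Longrightarrow> partition_fun N q (\<lambda>x. u) n = (\<Sum>j\<le>q. u j)\<^sup>2 * c ^ (2 ^ n - 2)"
proof (induction n rule: nat_induct_at_least)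
  case (Suc n)
  have "(2 :: nat) ^ Suc n - 2 = 2 ^ n + (2 ^ n - 2)"
    using Suc.hyps power_increasing[of 1 n "2 :: nat"] by simp
  thus ?case using Suc by (simp only: partition_fun_Suc power_add) (simp add: mult_ac)
qed (simp add: partition_fun_1[simplified])

lemma partition_fun_nonzero: "n \<ge> 1 \<Longrightarrow> partition_fun N q (\<lambda>x. u) n \<noteq> 0"
  using S0 c0 by (simp add: partition_fun_eq)

lemma compatible: "compatible N q (\<lambda>x. u)"
  unfolding compatible_def
proof (intro allI impI ballI)
  fix n \<sigma> assume "n \<ge> (2 :: nat)" and \<sigma>: "\<sigma> \<in> Conf q (Vn (n - 1))"
  then obtain k where k: "n = Suc k" "k \<ge> 1" by (cases n) auto
  have "(\<Sum>\<omega>\<in>Conf q (Wn (Suc k)). gibbs_n N q (\<lambda>x. u) (Suc k) (join (Suc k) \<sigma> \<omega>)) =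
      1 / partition_fun N q (\<lambda>x. u) (Suc k) * (c ^ 2 ^ k * weight N (\<lambda>x. u) k \<sigma>)"
    using \<sigma> k by (simp only: gibbs_n_def sum_distrib_left[symmetric] sum_weight_join diff_Suc_1)
  \<comment> \<open>The factor \<open>c ^ 2 ^ k\<close> also separates the two partition functions
    and cancels.\<close>
  also have "\<dots> = gibbs_n N q (\<lambda>x. u) k \<sigma>"
    using k c0 by (simp add: partition_fun_Suc gibbs_n_def)
  finally show "(\<Sum>\<omega>\<in>Conf q (Wn n). gibbs_n N q (\<lambda>x. u) n (join n \<sigma> \<omega>)) = gibbs_n N q (\<lambda>x. u) (n - 1) \<sigma>"
    by (simp add: k)
qed

lemmas quasi_gibbs = quasi_gibbs_gibbs_measure[of "\<lambda>x. u", OF u0 partition_fun_nonzero compatible]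

end

section \<open>Bounds on the measures\<close>

text \<open>Parity is counted back from level \<open>n\<close>, so that the boundary carries
  \<open>m\<close> for even and odd \<open>n\<close> alike and the boundary product is a pure power
  of \<open>u m\<close>.\<close>

definition level_alternating :: "nat \<Rightarrow> nat \<Rightarrow> config" where
  "level_alternating m n = restrict (\<lambda>x. if even (n - length x) then m else 0) (Vn n)"

lemma level_alternating_in_Conf: "m \<le> q \<Longrightarrow> level_alternating m n \<in> Conf q (Vn n)"
  by (auto simp: level_alternating_def Conf_def)

lemma hamiltonian_level_alternating:
  assumes "m \<noteq> 0"
  shows "hamiltonian N n (level_alternating m n) = 0"
proof -
  have "level_alternating m n y \<noteq> level_alternating m n (tl y)" if "2 \<le> length y" "length y \<le> n" for y
  proof -
    have "y \<in> Vn n" "tl y \<in> Vn n" "n - length (tl y) = Suc (n - length y)"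
      using that by (cases y; auto simp: Vn_eq)+
    thus ?thesis using assms by (simp only: level_alternating_def restrict_apply even_Suc) simp
  qed
  hence "(\<Sum>y | 2 \<le> length y \<and> length y \<le> n.
      if level_alternating m n y = level_alternating m n (tl y) then 1 else 0 :: nat) = 0"
    by (intro sum.neutral) auto
  thus ?thesis by (simp only: hamiltonian_eq mult_0_right)
qed

lemma weight_level_alternating:
  assumes "m \<noteq> 0" "n \<ge> 1"
  shows "weight N (\<lambda>x. u) n (level_alternating m n) = u m ^ 2 ^ n"
proof -
  have "(\<Prod>x\<in>Wn n. u (level_alternating m n x)) = (\<Prod>x\<in>Wn n. u m)"
    using assms(2) by (intro prod.cong refl) (auto simp: level_alternating_def Wn_eq Vn_eq)
  thus ?thesis by (simp add: weight_def hamiltonian_level_alternating[OF assms(1)] card_Wn)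
qed

lemma not_padic_boundedI:
  assumes "\<And>n. n \<ge> 1 \<Longrightarrow> A n \<in> Conf q (Vn n)"
    and lim: "filterlim (\<lambda>n. padic_abs (\<mu> (cylinder q n (A n)))) at_top sequentially"
  shows "\<not> padic_bounded q \<mu>"
proof
  assume "padic_bounded q \<mu>"
  then obtain C where C: "\<And>X. X \<in> cylinder_algebra q \<Longrightarrow> padic_abs (\<mu> X) \<le> C"
    by (auto simp: padic_bounded_def bdd_above_def)
  have "eventually (\<lambda>n. C < padic_abs (\<mu> (cylinder q n (A n)))) sequentially"
    using lim by (auto simp: filterlim_at_top_dense)
  then obtain k where k: "\<And>n. n \<ge> k \<Longrightarrow> C < padic_abs (\<mu> (cylinder q n (A n)))"
    by (auto simp: eventually_sequentially)
  \<comment> \<open>Sets of the algebra are described at levels from 1 on.\<close>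
  define n where "n = max 1 k"
  have "cylinder q n (A n) = \<Union>(cylinder q n ` {A n})" "n \<ge> 1" "{A n} \<subseteq> Conf q (Vn n)"
    using assms(1)[of n] by (auto simp: n_def)
  hence "cylinder q n (A n) \<in> cylinder_algebra q" unfolding cylinder_algebra_def by blast
  with C k[of n] show False by (force simp: n_def)
qed

lemma filterlim_power2_sequentially: "filterlim (\<lambda>n. (2 :: nat) ^ n) sequentially sequentially"
  by (rule filterlim_at_top_mono[OF filterlim_ident]) (simp add: less_imp_le)

lemma filterlim_power_power2_at_top:
  assumes "(a :: real) > 1"
  shows "filterlim (\<lambda>n. a ^ 2 ^ n) at_top sequentially"
proof -
  have "filterlim (\<lambda>n. a ^ n) at_top sequentially"
    using assms by (intro filterlim_at_infinity_imp_filterlim_at_top filterlim_realpow_sequentially_gt1) auto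
  thus ?thesis by (rule filterlim_compose[OF _ filterlim_power2_sequentially])
qed

lemma LIMSEQ_power_power2_zero:
  assumes "0 \<le> (a :: real)" "a < 1"
  shows "(\<lambda>n. a ^ 2 ^ n) \<longlonglongrightarrow> 0"
  by (rule filterlim_compose[OF LIMSEQ_realpow_zero[OF assms] filterlim_power2_sequentially])

section \<open>Growth and decay along the levels\<close>

context ti_boundary_law
begin

abbreviation "\<mu> \<equiv> gibbs_measure N q (\<lambda>x. u)"

text \<open>Trading the exponent \<open>2 ^ n - 2\<close> for \<open>2 ^ n\<close> makes the
  partition function comparable with a product over the \<open>2 ^ n\<close> boundary
  vertices.\<close>

lemma padic_abs_partition_fun:
  assumes "n \<ge> 1"
  shows "padic_abs (partition_fun N q (\<lambda>x. u) n) =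
    padic_abs c ^ 2 ^ n * (padic_abs (\<Sum>j\<le>q. u j) / padic_abs c)\<^sup>2"
proof -
  have "(2 :: nat) ^ n = 2 + (2 ^ n - 2)" using power_increasing[OF assms, of "2 :: nat"] by simp
  hence "padic_abs c ^ 2 ^ n = (padic_abs c)\<^sup>2 * padic_abs c ^ (2 ^ n - 2)"
    by (metis power_add)
  thus ?thesis using c0 assms
    by (simp add: partition_fun_eq padic_abs_mult padic_abs_power power_divide)
qed

text \<open>Powers of the prime have size at most 1 and each of the \<open>2 ^ n\<close> boundary
  factors at most \<open>|c|\<close>, so the weights grow no faster than the partition function.
  \<open>M\<close> is the constant left over, and the ultrametric inequality carries it to all sets
  of the algebra.\<close>

lemma padic_bounded_measure:
  assumes le: "\<And>i. i \<le> q \<Longrightarrow> padic_abs (u i) \<le> padic_abs c"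
  shows "padic_bounded q \<mu>"
proof -
  define M where "M = inverse ((padic_abs (\<Sum>j\<le>q. u j) / padic_abs c)\<^sup>2)"
  have M: "M \<ge> 0" by (simp add: M_def)
  have gibbs: "padic_abs (gibbs_n N q (\<lambda>x. u) n \<sigma>) \<le> M" if n: "n \<ge> 1" and \<sigma>: "\<sigma> \<in> Conf q (Vn n)" for n \<sigma>
  proof -
    have "(\<Prod>x\<in>Wn n. padic_abs (u (\<sigma> x))) \<le> (\<Prod>x\<in>Wn n. padic_abs c)"
    proof (intro prod_mono conjI)
      fix x assume "x \<in> Wn n"
      hence "x \<in> Vn n" using n by (auto simp: Vn_eq Wn_eq)
      thus "padic_abs (u (\<sigma> x)) \<le> padic_abs c" using \<sigma> by (intro le) (auto simp: Conf_def)
    qed simp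
    moreover have "padic_abs (of_nat (pchar TYPE('p)) ^ hamiltonian N n \<sigma> :: 'p padic) \<le> 1"
      by (simp add: padic_abs_power padic_abs_of_nat_le_1 power_le_one)
    ultimately have "padic_abs (weight N (\<lambda>x. u) n \<sigma>) \<le> 1 * padic_abs c ^ 2 ^ n"
      unfolding weight_def padic_abs_mult padic_abs_prod
      by (intro mult_mono) (auto simp: card_Wn intro: prod_nonneg)
    moreover have "padic_abs (gibbs_n N q (\<lambda>x. u) n \<sigma>) =
        M * (padic_abs (weight N (\<lambda>x. u) n \<sigma>) / padic_abs c ^ 2 ^ n)"
      using n by (simp add: gibbs_n_def M_def padic_abs_mult padic_abs_divide padic_abs_partition_fun field_simps)
    moreover have "padic_abs (weight N (\<lambda>x. u) n \<sigma>) / padic_abs c ^ 2 ^ n \<le> 1"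
      using calculation(1) c0 by simp
    ultimately show ?thesis using M by (simp only: mult_left_le)
  qed
  show ?thesis unfolding padic_bounded_def
  proof (rule bdd_aboveI2)
    fix A assume "A \<in> cylinder_algebra q"
    then obtain n B where n: "n \<ge> 1" "B \<subseteq> Conf q (Vn n)" "A = \<Union>(cylinder q n ` B)"
      by (auto simp: cylinder_algebra_def)
    hence "\<mu> A = (\<Sum>\<sigma>\<in>B. gibbs_n N q (\<lambda>x. u) n \<sigma>)" using quasi_gibbs(2) by simp
    also have "padic_abs \<dots> \<le> M"
      using n M finite_subset[OF n(2) finite_Conf_V] by (intro padic_abs_sum_le gibbs) auto
    finally show "padic_abs (\<mu> A) \<le> M" .
  qed
qed

lemma padic_abs_level_alternating:
  assumes "m \<in> {1..q}" "n \<ge> 1"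
  shows "padic_abs (\<mu> (cylinder q n (level_alternating m n))) =
    (padic_abs (u m) / padic_abs c) ^ 2 ^ n * (padic_abs c / padic_abs (\<Sum>j\<le>q. u j))\<^sup>2"
proof -
  have "\<mu> (cylinder q n (level_alternating m n)) = gibbs_n N q (\<lambda>x. u) n (level_alternating m n)"
    using quasi_gibbs(1) assms level_alternating_in_Conf[of m q n] by (auto simp: quasi_gibbs_def)
  also have "\<dots> = 1 / partition_fun N q (\<lambda>x. u) n * u m ^ 2 ^ n"
    using assms by (simp add: gibbs_n_def weight_level_alternating)
  finally show ?thesis using assms(2)
    by (simp add: padic_abs_mult padic_abs_divide padic_abs_partition_fun padic_abs_power power_divide)
qed

lemma level_alternating_at_top:
  assumes m: "m \<in> {1..q}" and gt: "padic_abs c < padic_abs (u m)"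
  shows "filterlim (\<lambda>n. padic_abs (\<mu> (cylinder q n (level_alternating m n)))) at_top sequentially"
proof -
  define K where "K = (padic_abs c / padic_abs (\<Sum>j\<le>q. u j))\<^sup>2"
  have "K > 0" using c0 S0 by (simp add: K_def)
  moreover have "padic_abs (u m) / padic_abs c > 1" using gt c0 by simp
  ultimately have "filterlim (\<lambda>n. K * (padic_abs (u m) / padic_abs c) ^ 2 ^ n) at_top sequentially"
    by (intro filterlim_tendsto_pos_mult_at_top[OF tendsto_const] filterlim_power_power2_at_top)
  \<comment> \<open>The closed formula holds from \<open>n = 1\<close> on, hence eventually.\<close>
  thus ?thesis
    by (rule filterlim_cong[THEN iffD1, OF refl refl, rotated])
      (use m in \<open>auto intro!: eventually_sequentiallyI[of 1] simp: padic_abs_level_alternating K_def\<close>)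
qed

lemma level_alternating_LIMSEQ_0:
  assumes m: "m \<in> {1..q}" and lt: "padic_abs (u m) < padic_abs c"
  shows "(\<lambda>n. padic_abs (\<mu> (cylinder q n (level_alternating m n)))) \<longlonglongrightarrow> 0"
proof -
  define K where "K = (padic_abs c / padic_abs (\<Sum>j\<le>q. u j))\<^sup>2"
  have "(\<lambda>n. K * (padic_abs (u m) / padic_abs c) ^ 2 ^ n) \<longlonglongrightarrow> K * 0"
    using lt c0 by (intro tendsto_mult tendsto_const LIMSEQ_power_power2_zero) auto
  hence "(\<lambda>n. K * (padic_abs (u m) / padic_abs c) ^ 2 ^ n) \<longlonglongrightarrow> 0" by simp
  thus ?thesis
    by (rule filterlim_cong[THEN iffD1, OF refl refl, rotated])
      (use m in \<open>auto intro!: eventually_sequentiallyI[of 1] simp: padic_abs_level_alternating K_def\<close>)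
qed

end

section \<open>The fixed points\<close>

lemma ti_vector_eq:
  assumes "ti_vector q m x h" "m \<in> {1..q}" "i \<le> q"
  shows "h i = (if i = m then x else 1) * h 0"
proof (cases "i = 0")
  case False
  have "h i / h 0 = (if i = m then x else 1)" "h 0 \<noteq> 0"
    using assms False by (auto simp: ti_vector_def)
  thus ?thesis by (metis nonzero_eq_divide_eq)
qed (use assms(2) in auto)

lemma sum_ti_vector:
  assumes "ti_vector q m x h" "m \<in> {1..q}"
  shows "(\<Sum>j\<le>q. h j) = (x + of_nat q) * h 0"
proof -
  have "(\<Sum>j\<le>q. h j) = h m + (\<Sum>j\<in>{..q} - {m}. h j)"
    using assms(2) by (intro sum.remove) auto
  also have "(\<Sum>j\<in>{..q} - {m}. h j) = (\<Sum>j\<in>{..q} - {m}. h 0)"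
  proof (intro sum.cong refl)
    fix j assume "j \<in> {..q} - {m}"
    thus "h j = h 0" using ti_vector_eq[OF assms, of j] by auto
  qed
  also have "\<dots> = of_nat q * h 0" using assms(2) by simp
  also have "h m = x * h 0" using ti_vector_eq[OF assms, of m] assms(2) by simp
  finally show ?thesis by (simp add: distrib_right)
qed

text \<open>For \<open>i = m\<close> the law is the fixed-point equation cleared of denominators.
  For the other \<open>i\<close> it is an identity, and this dictates the choice of
  \<open>c\<close>.\<close>

lemma ti_boundary_law_ti_vector:
  fixes x \<theta> :: "'p padic"
  assumes h: "ti_vector q m x h" and m: "m \<in> {1..q}" and \<theta>: "\<theta> = of_nat (pchar TYPE('p)) ^ N"
    and fixed: "(\<theta> * x + of_nat q)\<^sup>2 = x * (x + \<theta> + of_nat q - 1)\<^sup>2"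
    and nz: "x + \<theta> + of_nat q - 1 \<noteq> 0" "x + of_nat q \<noteq> 0"
  shows "ti_boundary_law N q h (h 0 * (x + \<theta> + of_nat q - 1)\<^sup>2)"
proof
  show h0: "h 0 \<noteq> 0" using h by (simp add: ti_vector_def)
  show "h 0 * (x + \<theta> + of_nat q - 1)\<^sup>2 \<noteq> 0" using h0 nz by simp
  show "(\<Sum>j\<le>q. h j) \<noteq> 0" using h0 nz by (simp add: sum_ti_vector[OF h m])
  fix i assume i: "i \<le> q"
  show "((\<Sum>j\<le>q. h j) + (of_nat (pchar TYPE('p)) ^ N - 1) * h i)\<^sup>2 =
      h 0 * (x + \<theta> + of_nat q - 1)\<^sup>2 * h i"
  proof (cases "i = m")
    case True
    have "(\<Sum>j\<le>q. h j) + (\<theta> - 1) * h i = (\<theta> * x + of_nat q) * h 0"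
      unfolding sum_ti_vector[OF h m] ti_vector_eq[OF h m i] using True by (simp add: algebra_simps)
    thus ?thesis unfolding \<theta>[symmetric] ti_vector_eq[OF h m i] using True
      by (simp only: power_mult_distrib fixed if_True) (simp add: power2_eq_square mult_ac)
  next
    case False
    have "(\<Sum>j\<le>q. h j) + (\<theta> - 1) * h i = (x + \<theta> + of_nat q - 1) * h 0"
      unfolding sum_ti_vector[OF h m] ti_vector_eq[OF h m i] using False by (simp add: algebra_simps)
    thus ?thesis unfolding \<theta>[symmetric] ti_vector_eq[OF h m i] using False
      by (simp only: power_mult_distrib if_False) (simp add: power2_eq_square mult_ac)
  qed
qed

lemma ti_vector_exists: "m \<in> {1..q} \<Longrightarrow> \<exists>h. ti_vector q m x h"
  by (intro exI[of _ "\<lambda>j. if j = m then x else 1"]) (auto simp: ti_vector_def)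

text \<open>Cleared of denominators, the fixed-point equation is a cubic with root 1, and the
  quadratic is the remaining factor.\<close>

lemma labelled_root_fixed:
  assumes "x\<^sup>2 + (2 * \<theta> - \<theta>\<^sup>2 + 2 * of_nat q - 1) * x + (of_nat q)\<^sup>2 = (0 :: 'p padic)"
  shows "(\<theta> * x + of_nat q)\<^sup>2 = x * (x + \<theta> + of_nat q - 1)\<^sup>2"
proof -
  have "x * (x + \<theta> + of_nat q - 1)\<^sup>2 - (\<theta> * x + of_nat q)\<^sup>2 =
      (x - 1) * (x\<^sup>2 + (2 * \<theta> - \<theta>\<^sup>2 + 2 * of_nat q - 1) * x + (of_nat q)\<^sup>2)"
    by algebra
  thus ?thesis using assms by simp
qed

section \<open>Sizes at the three fixed points\<close>

context
  fixes q N :: nat and \<theta> :: "'p padic"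
  assumes \<theta>: "\<theta> = of_nat (pchar TYPE('p)) ^ N" and q: "q \<ge> 1"
    and q_small: "padic_abs (of_nat q :: 'p padic) < 1"
    and \<theta>_small: "padic_abs \<theta> \<le> (padic_abs (of_nat q :: 'p padic))\<^sup>2"
begin

lemma of_nat_q_nonzero: "of_nat q \<noteq> (0 :: 'p padic)"
proof -
  have "padic_abs (of_nat q :: 'p padic) \<noteq> 0"
    using q by (simp add: padic_abs_of_nat rat_pabs_eq_0[OF prime_pchar] del: padic_abs_eq_0_iff)
  thus ?thesis by simp
qed

lemma q_square_less: "(padic_abs (of_nat q :: 'p padic))\<^sup>2 < padic_abs (of_nat q :: 'p padic)"
  using q_small of_nat_q_nonzero by (simp add: power2_eq_square mult_less_cancel_left1)

lemma theta_less: "padic_abs \<theta> < padic_abs (of_nat q :: 'p padic)"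
  using \<theta>_small q_square_less by linarith

text \<open>The linear coefficient is a unit and the constant term is small, so the contraction
  gives one small root; the sum and product of the roots give the rest.\<close>

lemma labelled_roots_exist: "\<exists>x1 x2. labelled_roots q \<theta> x1 x2"
proof -
  \<comment> \<open>Rational preimages of the coefficients, as
    \<open>padic_small_root_quadratic\<close> works with rational ones.\<close>
  define t b c :: rat where "t = of_nat (pchar TYPE('p)) ^ N"
    and "b = 2 * t - t\<^sup>2 + 2 * of_nat q - 1" and "c = (of_nat q)\<^sup>2"
  have of_rat: "padic_of_rat 1 = (1 :: 'p padic)" "padic_of_rat 2 = (2 :: 'p padic)"
    using padic_of_rat_of_nat[of 1, where ?'p = 'p] padic_of_rat_of_nat[of 2, where ?'p = 'p] by simp_all
  define B where "B = 2 * \<theta> - \<theta>\<^sup>2 + 2 * of_nat q - 1"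
  have B: "padic_of_rat b = B"
    by (simp add: b_def t_def B_def \<theta> padic_of_rat_add padic_of_rat_diff padic_of_rat_mult
        padic_of_rat_power padic_of_rat_of_nat of_rat)
  have c: "padic_of_rat c = (of_nat q)\<^sup>2"
    by (simp add: c_def padic_of_rat_power padic_of_rat_of_nat)
  \<comment> \<open>The summand \<open>-1\<close> dominates: the others have size below 1, since
    doubling does not enlarge and |\<theta>| < |q| < 1.\<close>
  have abs_B: "padic_abs B = 1"
  proof -
    have "padic_abs (of_nat 2 :: 'p padic) \<le> 1" by (rule padic_abs_of_nat_le_1)
    hence le: "padic_abs (2 * y :: 'p padic) \<le> padic_abs y" for y
      by (simp add: padic_abs_mult mult_left_le_one_le)
    have "padic_abs (\<theta>\<^sup>2) \<le> padic_abs \<theta>"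
      using theta_less q_small by (simp add: padic_abs_mult power2_eq_square mult_left_le_one_le)
    hence "padic_abs (2 * \<theta> + - \<theta>\<^sup>2 + 2 * of_nat q) < 1"
      using padic_abs_add_le_max[of "2 * \<theta> + - \<theta>\<^sup>2" "2 * of_nat q"]
        padic_abs_add_le_max[of "2 * \<theta>" "- \<theta>\<^sup>2"] le[of \<theta>] le[of "of_nat q"] theta_less q_small by simp
    thus ?thesis using padic_abs_add_eq[of "2 * \<theta> + - \<theta>\<^sup>2 + 2 * of_nat q" "-1"] by (simp add: B_def)
  qed
  have q2: "(padic_abs (of_nat q :: 'p padic))\<^sup>2 < 1" using q_square_less q_small by linarith
  have b1: "rat_pabs (pchar TYPE('p)) b = 1"
    by (simp only: padic_abs_of_rat[symmetric] B abs_B)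
  have c1: "rat_pabs (pchar TYPE('p)) c < 1"
    using q2 by (simp only: padic_abs_of_rat[symmetric] c padic_abs_power)
  obtain x :: "'p padic" where x: "x\<^sup>2 + B * x + (of_nat q)\<^sup>2 = 0"
      "padic_abs x \<le> (padic_abs (of_nat q :: 'p padic))\<^sup>2"
    using padic_small_root_quadratic[OF b1 c1] unfolding B c padic_abs_power .
  \<comment> \<open>The second root, from the sum of the roots; as \<open>x\<close> is small it
    inherits the size of \<open>B\<close>.\<close>
  define y where "y = - B - x"
  have "y\<^sup>2 + B * y + (of_nat q)\<^sup>2 = x\<^sup>2 + B * x + (of_nat q)\<^sup>2"
    unfolding y_def by (simp add: power2_eq_square algebra_simps)
  hence y: "y\<^sup>2 + B * y + (of_nat q)\<^sup>2 = 0" using x(1) by simp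
  have abs_y: "padic_abs y = 1"
    using padic_abs_add_eq[of "- x" "- B"] x(2) q2 by (simp add: y_def abs_B)
  \<comment> \<open>The product of the roots, with \<open>y\<close> a unit, sharpens the bound on
    \<open>x\<close> to an equality.\<close>
  have "x * y = (of_nat q)\<^sup>2 - (x\<^sup>2 + B * x + (of_nat q)\<^sup>2)"
    unfolding y_def by (simp add: power2_eq_square algebra_simps)
  hence "x * y = (of_nat q)\<^sup>2" using x(1) by simp
  hence "padic_abs x * padic_abs y = padic_abs ((of_nat q)\<^sup>2 :: 'p padic)"
    by (metis padic_abs_mult)
  hence "padic_abs x = (padic_abs (of_nat q :: 'p padic))\<^sup>2" by (simp add: abs_y padic_abs_power)
  with x y abs_y show ?thesis unfolding labelled_roots_def B_def by blast
qed

context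
  fixes m and x :: "'p padic" and h :: "nat \<Rightarrow> 'p padic"
  assumes m: "m \<in> {1..q}" and h: "ti_vector q m x h"
begin

lemma padic_abs_ti_vector: "h 0 \<noteq> 0" "padic_abs (h m) = padic_abs x * padic_abs (h 0)"
  using h ti_vector_eq[OF h m, of m] m by (auto simp: ti_vector_def padic_abs_mult)

text \<open>Cancellation in \<open>D\<close> prevents a direct estimate, so its size comes from the
  fixed-point equation: |\<theta> x + q| = |q| forces |D| = |q|. Hence \<open>c\<close> has size
  \<open>|h 0| |q|^2\<close>, below \<open>|h m| = |h 0|\<close>.\<close>

lemma ti_boundary_law_unit:
  assumes x: "padic_abs x = 1" and fixed: "(\<theta> * x + of_nat q)\<^sup>2 = x * (x + \<theta> + of_nat q - 1)\<^sup>2"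
  obtains c where "ti_boundary_law N q h c" "padic_abs c < padic_abs (h m)"
proof -
  define D where "D = x + \<theta> + of_nat q - 1"
  have "padic_abs (\<theta> * x + of_nat q) = padic_abs (of_nat q :: 'p padic)"
    using padic_abs_add_eq[of "\<theta> * x" "of_nat q"] theta_less x by (simp add: padic_abs_mult add.commute)
  hence D: "padic_abs (D\<^sup>2) = (padic_abs (of_nat q :: 'p padic))\<^sup>2"
    using arg_cong[OF fixed, of padic_abs] x by (simp add: D_def padic_abs_mult padic_abs_power)
  have "D \<noteq> 0" using D of_nat_q_nonzero by auto
  moreover have "x + of_nat q \<noteq> 0"
    using padic_abs_add_eq[of "of_nat q" x] q_small x by auto
  ultimately have "ti_boundary_law N q h (h 0 * D\<^sup>2)"
    unfolding D_def by (intro ti_boundary_law_ti_vector[OF h m \<theta> fixed])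
  moreover have "padic_abs (h 0 * D\<^sup>2) < padic_abs (h m)"
    using q_square_less q_small padic_abs_ti_vector by (simp add: x D padic_abs_mult)
  ultimately show ?thesis by (rule that)
qed

text \<open>Here \<open>-1\<close> dominates in \<open>D\<close>, so \<open>|c| = |h 0|\<close>,
  while \<open>|h m|\<close> is smaller by the factor \<open>|q|^2\<close>. The other coordinates
  equal \<open>h 0\<close>.\<close>

lemma ti_boundary_law_small:
  assumes x: "padic_abs x = (padic_abs (of_nat q :: 'p padic))\<^sup>2"
    and fixed: "(\<theta> * x + of_nat q)\<^sup>2 = x * (x + \<theta> + of_nat q - 1)\<^sup>2"
  obtains c where "ti_boundary_law N q h c" "padic_abs (h m) < padic_abs c"
    "\<And>i. i \<le> q \<Longrightarrow> padic_abs (h i) \<le> padic_abs c"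
proof -
  define D where "D = x + \<theta> + of_nat q - 1"
  have "padic_abs (x + \<theta> + of_nat q) < 1"
    using padic_abs_add_le_max[of "x + \<theta>" "of_nat q"] padic_abs_add_le_max[of x \<theta>]
      theta_less q_square_less q_small x by simp
  hence D: "padic_abs D = 1"
    using padic_abs_add_eq[of "x + \<theta> + of_nat q" "-1"] by (simp add: D_def)
  have x1: "padic_abs x < 1" using x q_square_less q_small by simp
  have "D \<noteq> 0" using D by auto
  moreover have "x + of_nat q \<noteq> 0"
    using padic_abs_add_eq[of x "of_nat q"] x q_square_less of_nat_q_nonzero by (auto simp: add.commute)
  ultimately have "ti_boundary_law N q h (h 0 * D\<^sup>2)"
    unfolding D_def by (intro ti_boundary_law_ti_vector[OF h m \<theta> fixed])
  moreover have c: "padic_abs (h 0 * D\<^sup>2) = padic_abs (h 0)"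
    by (simp add: padic_abs_mult padic_abs_power D)
  moreover have "padic_abs (h m) < padic_abs (h 0)"
    using x1 padic_abs_ti_vector by simp
  moreover have "padic_abs (h i) \<le> padic_abs (h 0)" if "i \<le> q" for i
    using ti_vector_eq[OF h m that] x1 by (auto simp: padic_abs_mult mult_left_le_one_le)
  ultimately show ?thesis using that by metis
qed

end

end

theorem theorem6p1:
  fixes p q N m :: nat and \<theta> :: "'p padic"
  assumes "p = CARD('p)" and "prime p" and "p \<ge> 3"
    and "q \<ge> 1" and "N \<ge> 1" and "\<theta> = of_nat p ^ N"
    and "padic_abs (of_nat q :: 'p padic) < 1"
    and "padic_abs \<theta> \<le> (padic_abs (of_nat q :: 'p padic))\<^sup>2"
    and "m \<in> {1..q}"
  shows
    "(\<exists>x1 x2. labelled_roots q \<theta> x1 x2) \<and>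
     (\<forall>(x1 :: 'p padic) (x2 :: 'p padic)
        (h0 :: nat \<Rightarrow> 'p padic) (h1 :: nat \<Rightarrow> 'p padic) (h2 :: nat \<Rightarrow> 'p padic).
        labelled_roots q \<theta> x1 x2 \<and>
        ti_vector q m 1 h0 \<and> ti_vector q m x1 h1 \<and> ti_vector q m x2 h2 \<longrightarrow>
        (let \<mu>0 = gibbs_measure N q (\<lambda>x. h0);
             \<mu>1 = gibbs_measure N q (\<lambda>x. h1);
             \<mu>2 = gibbs_measure N q (\<lambda>x. h2)
         in quasi_gibbs N q (\<lambda>x. h0) \<mu>0 \<and>
            quasi_gibbs N q (\<lambda>x. h1) \<mu>1 \<and>
            quasi_gibbs N q (\<lambda>x. h2) \<mu>2 \<and>
            padic_bounded q \<mu>1 \<and>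
            \<not> padic_bounded q \<mu>0 \<and>
            \<not> padic_bounded q \<mu>2)) \<and>
     strong_phase_transition TYPE('p) N q"
proof -
  have \<theta>: "\<theta> = of_nat (pchar TYPE('p)) ^ N" using assms(1,2,6) by (simp add: pchar_def)
  note hyps = \<theta> assms(4,7,8)
  note m = assms(9)
  have alt: "level_alternating m n \<in> Conf q (Vn n)" for n
    using m by (intro level_alternating_in_Conf) simp
  \<comment> \<open>Treats the fixed points 1 and \<open>x2\<close> together, both of size
    1.\<close>
  have unit: "quasi_gibbs N q (\<lambda>x. h) (gibbs_measure N q (\<lambda>x. h)) \<and>
      filterlim (\<lambda>n. padic_abs (gibbs_measure N q (\<lambda>x. h) (cylinder q n (level_alternating m n)))) at_top sequentially \<and>
      \<not> padic_bounded q (gibbs_measure N q (\<lambda>x. h))"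
    if ti: "ti_vector q m x h" "padic_abs x = 1" "(\<theta> * x + of_nat q)\<^sup>2 = x * (x + \<theta> + of_nat q - 1)\<^sup>2"
    for x :: "'p padic" and h
  proof -
    obtain c where "ti_boundary_law N q h c" and c: "padic_abs c < padic_abs (h m)"
      using ti_boundary_law_unit[OF hyps m ti] by blast
    then interpret ti_boundary_law N q h c by simp
    show ?thesis
      using quasi_gibbs(1) level_alternating_at_top[OF m c] not_padic_boundedI[OF alt] by blast
  qed
  have small: "quasi_gibbs N q (\<lambda>x. h) (gibbs_measure N q (\<lambda>x. h)) \<and>
      (\<lambda>n. padic_abs (gibbs_measure N q (\<lambda>x. h) (cylinder q n (level_alternating m n)))) \<longlonglongrightarrow> 0 \<and>
      padic_bounded q (gibbs_measure N q (\<lambda>x. h))"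
    if ti: "ti_vector q m x h" "padic_abs x = (padic_abs (of_nat q :: 'p padic))\<^sup>2"
      "(\<theta> * x + of_nat q)\<^sup>2 = x * (x + \<theta> + of_nat q - 1)\<^sup>2"
    for x :: "'p padic" and h
  proof -
    obtain c where "ti_boundary_law N q h c" and c: "padic_abs (h m) < padic_abs c"
        "\<And>i. i \<le> q \<Longrightarrow> padic_abs (h i) \<le> padic_abs c"
      using ti_boundary_law_small[OF hyps m ti] by blast
    then interpret ti_boundary_law N q h c by simp
    show ?thesis
      using quasi_gibbs(1) level_alternating_LIMSEQ_0[OF m c(1)] padic_bounded_measure[OF c(2)] by blast
  qed
  have fixed1: "(\<theta> * 1 + of_nat q)\<^sup>2 = 1 * (1 + \<theta> + of_nat q - 1)\<^sup>2" by simp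
  obtain x1 x2 where roots: "labelled_roots q \<theta> x1 x2" using labelled_roots_exist[OF hyps] by blast
  have root: "padic_abs x1 = (padic_abs (of_nat q :: 'p padic))\<^sup>2" "padic_abs x2 = 1"
      "(\<theta> * x1 + of_nat q)\<^sup>2 = x1 * (x1 + \<theta> + of_nat q - 1)\<^sup>2"
      "(\<theta> * x2 + of_nat q)\<^sup>2 = x2 * (x2 + \<theta> + of_nat q - 1)\<^sup>2"
    if "labelled_roots q \<theta> x1 x2" for x1 x2
    using that by (auto simp: labelled_roots_def intro: labelled_root_fixed)
  obtain h0 h1 where h: "ti_vector q m (1 :: 'p padic) h0" "ti_vector q m x1 h1"
    using ti_vector_exists[OF m] by metis
  \<comment> \<open>The bounded measure comes from \<open>x1\<close> and the unbounded one from the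
    fixed point 1; the same alternating configurations serve both limits.\<close>
  have strong: "strong_phase_transition TYPE('p) N q"
    unfolding strong_phase_transition_def phase_transition_pair_def
    using small[OF h(2) root(1,3)[OF roots]] unit[OF h(1) padic_abs_1 fixed1] alt by blast
  have measures: "quasi_gibbs N q (\<lambda>x. h0) (gibbs_measure N q (\<lambda>x. h0)) \<and>
      quasi_gibbs N q (\<lambda>x. h1) (gibbs_measure N q (\<lambda>x. h1)) \<and>
      quasi_gibbs N q (\<lambda>x. h2) (gibbs_measure N q (\<lambda>x. h2)) \<and>
      padic_bounded q (gibbs_measure N q (\<lambda>x. h1)) \<and>
      \<not> padic_bounded q (gibbs_measure N q (\<lambda>x. h0)) \<and>
      \<not> padic_bounded q (gibbs_measure N q (\<lambda>x. h2))"
    if "labelled_roots q \<theta> x1 x2" "ti_vector q m 1 h0" "ti_vector q m x1 h1" "ti_vector q m x2 h2"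
    for x1 x2 :: "'p padic" and h0 h1 h2 :: "nat \<Rightarrow> 'p padic"
    using unit[OF that(2) padic_abs_1 fixed1] small[OF that(3) root(1,3)[OF that(1)]]
      unit[OF that(4) root(2,4)[OF that(1)]] by (intro conjI) simp_all
  show ?thesis
    unfolding Let_def
    by (rule conjI, intro exI, rule roots, rule conjI[OF _ strong], intro allI impI, elim conjE, rule measures)
qed

end
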